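(* Let $E$ be a real Hausdorff infrabarreled locally convex space and $C\subset E$ a convex subset. Then $$\mathrm{bDP}(C)=\mathrm{bPC}(C)\cap \mathrm{ext}(\widehat{C}),$$ where points $x\in C$ are identified with their canonical images in $E^{**}$.
   Context: $(E,\tau)$ is a real Hausdorff locally convex space, $\tau(x)$ is the family of $\tau$-neighbourhoods of $x$, $E^*$ its topological dual, $\sigma(E,E^* )(x)$ the family of weak neighbourhoods of $x$. $E$ is infrabarreled if every barrel (closed, convex, balanced, absorbent set) in $E$ which absorbs all bounded sets is a neighbourhood of $0$. The strong topology $\beta(E^*,E)$ on $E^*$ is the topology of uniform convergence on bounded subsets of $E$; $E^{**}$ is the dual of $(E^*,\beta(E^*,E))$; $\beta(E^{**},E^* )$ is the strong topology on $E^{**}$, i.e. of uniform convergence on $\beta(E^*,E)$-bounded subsets of $E^*$. $J_E:E\to E^{**}$, $J_E(x)(x^* )=x^*(x)$, is used to identify $x$ with $J_E(x)$. $\widehat{C}$ is the $\beta(E^{**},E^* )$-closure of $J_E(C)$ in $E^{**}$. For convex $C\subset E$ and $x\in C$: - $x\in \mathrm{DP}(C)$ if for every $U\in\tau(x)$, $x\notin\overline{\mathrm{conv}}(C\setminus U)$; $x\in\mathrm{bDP}(C)$ if moreover there is $W\in\sigma(E,E^* )(x)$ with $W\cap C$ bounded. - $x\in \mathrm{PC}(C)$ if for every $U\in\tau(x)$ there is $W\in\sigma(E,E^* )(x)$ with $W\cap C\subset U$; $x\in\mathrm{bPC}(C)$ if moreover there is $W\in\sigma(E,E^* )(x)$ with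 $W\cap C$ bounded. For a convex set $D$ in a vector space, $x\in\mathrm{ext}(D)$ if $x\in D$ and $x=\frac{d_1+d_2}{2}$ with $d_1,d_2\in D$ implies $x=d_1=d_2$. *)

theory Defs
  imports "HOL-Analysis.Analysis"
begin

section \<open>Hausdorff locally convex spaces\<close>

class locally_convex_space = real_vector + topological_ab_group_add + t2_space +
  assumes tendsto_scaleR_lcs:
    "filterlim (\<lambda>p. fst p *\<^sub>R snd p) (nhds (a *\<^sub>R x)) (nhds a \<times>\<^sub>F nhds x)"
  (* the third conjunct is convexity of V; the constant convex is not available
     inside a class specification *)
  assumes convex_nhds_base:
    "open U \<Longrightarrow> x \<in> U \<Longrightarrow>
      \<exists>V. open V \<and> x \<in> V \<and>
        (\<forall>a\<in>V. \<forall>b\<in>V. \<forall>u\<ge>0. \<forall>v\<ge>0. u + v = 1 \<longrightarrow> u *\<^sub>R a + v *\<^sub>R b \<in> V) \<and> V \<subseteq> U"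

definition neighbourhoods :: "'a topology \<Rightarrow> 'a \<Rightarrow> 'a set set" where
  "neighbourhoods T x = {U. \<exists>V. openin T V \<and> x \<in> V \<and> V \<subseteq> U}"

definition absorbs :: "'a::real_vector set \<Rightarrow> 'a set \<Rightarrow> bool" where
  "absorbs A B \<longleftrightarrow> (\<exists>r>0. \<forall>t. r \<le> \<bar>t\<bar> \<longrightarrow> B \<subseteq> (\<lambda>x. t *\<^sub>R x) ` A)"

definition absorbent :: "'a::real_vector set \<Rightarrow> bool" where
  "absorbent A \<longleftrightarrow> (\<forall>x. absorbs A {x})"

definition balanced :: "'a::real_vector set \<Rightarrow> bool" where
  "balanced A \<longleftrightarrow> (\<forall>t. \<bar>t\<bar> \<le> 1 \<longrightarrow> (\<lambda>x. t *\<^sub>R x) ` A \<subseteq> A)"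

(* von Neumann boundedness; the library constant bounded is metric *)
definition vn_bounded :: "'a::{real_vector, topological_space} set \<Rightarrow> bool" where
  "vn_bounded B \<longleftrightarrow> (\<forall>U \<in> neighbourhoods euclidean 0. absorbs U B)"

definition barrel :: "'a::locally_convex_space set \<Rightarrow> bool" where
  "barrel A \<longleftrightarrow> closed A \<and> convex A \<and> balanced A \<and> absorbent A"

definition infrabarreled :: "'a::locally_convex_space itself \<Rightarrow> bool" where
  "infrabarreled _ \<longleftrightarrow>
    (\<forall>A :: 'a set. barrel A \<and> (\<forall>B. vn_bounded B \<longrightarrow> absorbs A B)
      \<longrightarrow> A \<in> neighbourhoods euclidean 0)"


section \<open>The strong dual\<close>

typedef (overloaded) 'a dual =
    "{f :: 'a::locally_convex_space \<Rightarrow> real. linear f \<and> continuous_on UNIV f}"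
  morphisms dual_apply Dual
  by (intro exI[of _ "\<lambda>_. 0"]) (auto intro: linear_zero)

setup_lifting type_definition_dual

lemma linear_dual_apply: "linear (dual_apply f)"
  using dual_apply by blast

lemma continuous_on_dual_apply: "continuous_on UNIV (dual_apply f)"
  using dual_apply by blast

lemma dual_eqI: "(\<And>x. dual_apply f x = dual_apply g x) \<Longrightarrow> f = g"
  by (simp add: dual_apply_inject[symmetric] fun_eq_iff)

instantiation dual :: (locally_convex_space) real_vector
begin

lift_definition zero_dual :: "'a dual" is "\<lambda>_. 0"
  by (auto intro: linear_zero)

lift_definition plus_dual :: "'a dual \<Rightarrow> 'a dual \<Rightarrow> 'a dual" is "\<lambda>f g x. f x + g x"
  by (auto intro: linear_compose_add continuous_on_add)

lift_definition minus_dual :: "'a dual \<Rightarrow> 'a dual \<Rightarrow> 'a dual" is "\<lambda>f g x. f x - g x"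
  by (auto intro: linear_compose_sub continuous_on_diff)

lift_definition uminus_dual :: "'a dual \<Rightarrow> 'a dual" is "\<lambda>f x. - f x"
  by (auto intro: linear_compose_neg continuous_on_minus)

lift_definition scaleR_dual :: "real \<Rightarrow> 'a dual \<Rightarrow> 'a dual" is "\<lambda>r f x. r *\<^sub>R f x"
  by (intro conjI linear_compose_scale_right continuous_on_scaleR continuous_on_const) auto

instance
  by standard
    (rule dual_eqI; simp add: zero_dual.rep_eq plus_dual.rep_eq minus_dual.rep_eq
      uminus_dual.rep_eq scaleR_dual.rep_eq algebra_simps)+

end

lemma absorbs_Un: "absorbs U A \<Longrightarrow> absorbs U B \<Longrightarrow> absorbs U (A \<union> B)"
  unfolding absorbs_def
proof (elim exE conjE)
  fix r s :: real
  assume "0 < r" "0 < s" "\<forall>t. r \<le> \<bar>t\<bar> \<longrightarrow> A \<subseteq> (\<lambda>x. t *\<^sub>R x) ` U"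
    "\<forall>t. s \<le> \<bar>t\<bar> \<longrightarrow> B \<subseteq> (\<lambda>x. t *\<^sub>R x) ` U"
  then show "\<exists>r>0. \<forall>t. r \<le> \<bar>t\<bar> \<longrightarrow> A \<union> B \<subseteq> (\<lambda>x. t *\<^sub>R x) ` U"
    by (intro exI[of _ "max r s"]) auto
qed

lemma vn_bounded_Un: "vn_bounded A \<Longrightarrow> vn_bounded B \<Longrightarrow> vn_bounded (A \<union> B)"
  by (simp add: vn_bounded_def absorbs_Un)

lemma vn_bounded_empty [simp]: "vn_bounded {}"
  by (auto simp: vn_bounded_def absorbs_def intro: exI[of _ 1])

(* the topology of uniform convergence on bounded sets *)
instantiation dual :: (locally_convex_space) topological_space
begin

definition open_dual :: "'a dual set \<Rightarrow> bool" where
  "open_dual U \<longleftrightarrow>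
    (\<forall>f\<in>U. \<exists>B. \<exists>e>0. vn_bounded B \<and>
      {g. \<forall>x\<in>B. \<bar>dual_apply g x - dual_apply f x\<bar> < e} \<subseteq> U)"

instance
proof
  show "open (UNIV :: 'a dual set)"
    by (auto simp: open_dual_def intro!: exI[of _ "{}"] exI[of _ 1])
next
  fix S T :: "'a dual set"
  assume S: "open S" and T: "open T"
  show "open (S \<inter> T)"
    unfolding open_dual_def
  proof
    fix f assume f: "f \<in> S \<inter> T"
    obtain A d where A: "vn_bounded A" "0 < d"
        "{g. \<forall>x\<in>A. \<bar>dual_apply g x - dual_apply f x\<bar> < d} \<subseteq> S"
      using S f unfolding open_dual_def by blast
    obtain B e where B: "vn_bounded B" "0 < e"
        "{g. \<forall>x\<in>B. \<bar>dual_apply g x - dual_apply f x\<bar> < e} \<subseteq> T"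
      using T f unfolding open_dual_def by blast
    show "\<exists>B. \<exists>e>0. vn_bounded B \<and>
        {g. \<forall>x\<in>B. \<bar>dual_apply g x - dual_apply f x\<bar> < e} \<subseteq> S \<inter> T"
    proof (intro exI conjI)
      show "0 < min d e" using A B by simp
      show "vn_bounded (A \<union> B)" using A B by (simp add: vn_bounded_Un)
      show "{g. \<forall>x\<in>A \<union> B. \<bar>dual_apply g x - dual_apply f x\<bar> < min d e} \<subseteq> S \<inter> T"
        using A(3) B(3) by auto
    qed
  qed
next
  fix K :: "'a dual set set"
  assume K: "\<forall>S\<in>K. open S"
  show "open (\<Union> K)"
    unfolding open_dual_def
  proof
    fix f assume "f \<in> \<Union> K"
    then obtain S where S: "S \<in> K" "f \<in> S" by blast
    then obtain B e where "vn_bounded B" "0 < e"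
        "{g. \<forall>x\<in>B. \<bar>dual_apply g x - dual_apply f x\<bar> < e} \<subseteq> S"
      using K unfolding open_dual_def by blast
    with S show "\<exists>B. \<exists>e>0. vn_bounded B \<and>
        {g. \<forall>x\<in>B. \<bar>dual_apply g x - dual_apply f x\<bar> < e} \<subseteq> \<Union> K"
      by blast
  qed
qed

end

lemma abs_diff_add_half:
  fixes f g h d e :: real
  assumes "\<bar>h - g\<bar> < (e - d) / 2" "\<bar>g - f\<bar> \<le> d"
  shows "\<bar>h - f\<bar> \<le> (e + d) / 2"
proof -
  have "\<bar>h - f\<bar> \<le> \<bar>h - g\<bar> + \<bar>g - f\<bar>"
    using abs_triangle_ineq[of "h - g" "g - f"] by simp
  also have "\<dots> \<le> (e - d) / 2 + d"
    using assms by (intro add_mono) (auto intro: less_imp_le)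
  also have "\<dots> = (e + d) / 2" by (simp add: field_simps)
  finally show ?thesis .
qed

lemma abs_add_diff_half:
  fixes f f' g g' e :: real
  assumes "\<bar>f' - f\<bar> < e / 2" "\<bar>g' - g\<bar> < e / 2"
  shows "\<bar>f' + g' - (f + g)\<bar> < e"
proof -
  have "\<bar>f' + g' - (f + g)\<bar> \<le> \<bar>f' - f\<bar> + \<bar>g' - g\<bar>"
    using abs_triangle_ineq[of "f' - f" "g' - g"] by (simp add: algebra_simps)
  also have "\<dots> < e / 2 + e / 2"
    using assms by (intro add_strict_mono)
  finally show ?thesis by simp
qed

lemma dual_ball:
  fixes f :: "'a::locally_convex_space dual"
  assumes "vn_bounded B" "0 < e"
  obtains V where "open V" "f \<in> V" "convex V"
    "\<And>g x. g \<in> V \<Longrightarrow> x \<in> B \<Longrightarrow> \<bar>dual_apply g x - dual_apply f x\<bar> < e"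
    "\<And>g. (\<And>x. x \<in> B \<Longrightarrow> \<bar>dual_apply g x - dual_apply f x\<bar> \<le> e / 2) \<Longrightarrow> g \<in> V"
proof
  let ?V = "{g. \<exists>d<e. \<forall>x\<in>B. \<bar>dual_apply g x - dual_apply f x\<bar> \<le> d}"
  show "open ?V"
    unfolding open_dual_def
  proof
    fix g assume "g \<in> ?V"
    then obtain d where d: "d < e" "\<forall>x\<in>B. \<bar>dual_apply g x - dual_apply f x\<bar> \<le> d" by blast
    show "\<exists>B. \<exists>e>0. vn_bounded B \<and>
        {h. \<forall>x\<in>B. \<bar>dual_apply h x - dual_apply g x\<bar> < e} \<subseteq> ?V"
    proof (intro exI conjI subsetI CollectI)
      show "0 < (e - d) / 2" "vn_bounded B" "(e + d) / 2 < e" using d assms by auto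
      fix h assume h: "h \<in> {h. \<forall>x\<in>B. \<bar>dual_apply h x - dual_apply g x\<bar> < (e - d) / 2}"
      show "\<forall>x\<in>B. \<bar>dual_apply h x - dual_apply f x\<bar> \<le> (e + d) / 2"
      proof
        fix x assume "x \<in> B"
        then have "\<bar>dual_apply h x - dual_apply g x\<bar> < (e - d) / 2"
          "\<bar>dual_apply g x - dual_apply f x\<bar> \<le> d"
          using h d by auto
        then show "\<bar>dual_apply h x - dual_apply f x\<bar> \<le> (e + d) / 2"
          by (rule abs_diff_add_half)
      qed
    qed
  qed
  show "f \<in> ?V" using assms by (auto intro: exI[of _ 0])
  show "convex ?V"
  proof (rule convexI, clarify)
    fix g h u v c d
    assume uv: "0 \<le> u" "0 \<le> v" "u + v = (1::real)"
      and c: "c < e" "\<forall>x\<in>B. \<bar>dual_apply g x - dual_apply f x\<bar> \<le> c"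
      and d: "d < e" "\<forall>x\<in>B. \<bar>dual_apply h x - dual_apply f x\<bar> \<le> d"
    have "\<bar>dual_apply (u *\<^sub>R g + v *\<^sub>R h) x - dual_apply f x\<bar> \<le> max c d" if "x \<in> B" for x
    proof -
      have "dual_apply (u *\<^sub>R g + v *\<^sub>R h) x - dual_apply f x =
          u * (dual_apply g x - dual_apply f x) + v * (dual_apply h x - dual_apply f x)"
      proof -
        have "dual_apply f x = (u + v) * dual_apply f x" using uv by simp
        then show ?thesis
          by (simp add: plus_dual.rep_eq scaleR_dual.rep_eq algebra_simps)
      qed
      also have "\<bar>\<dots>\<bar> \<le> u * \<bar>dual_apply g x - dual_apply f x\<bar> + v * \<bar>dual_apply h x - dual_apply f x\<bar>"
        using uv by (metis abs_mult abs_of_nonneg abs_triangle_ineq)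
      also have "\<dots> \<le> u * max c d + v * max c d"
        using c d uv that by (intro add_mono mult_left_mono) (auto simp: le_max_iff_disj)
      also have "\<dots> = max c d" using uv by (metis distrib_right mult_1)
      finally show ?thesis .
    qed
    with c d show "\<exists>d<e. \<forall>x\<in>B. \<bar>dual_apply (u *\<^sub>R g + v *\<^sub>R h) x - dual_apply f x\<bar> \<le> d"
      by (intro exI[of _ "max c d"]) auto
  qed
  show "\<bar>dual_apply g x - dual_apply f x\<bar> < e" if "g \<in> ?V" "x \<in> B" for g x
    using that by force
  show "g \<in> ?V" if "\<And>x. x \<in> B \<Longrightarrow> \<bar>dual_apply g x - dual_apply f x\<bar> \<le> e / 2" for g
    using that assms by (intro CollectI exI[of _ "e / 2"]) auto
qed

lemma eventually_nhds_dual: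
  "eventually P (nhds f) \<longleftrightarrow>
    (\<exists>B. \<exists>e>0. vn_bounded B \<and>
      (\<forall>g. (\<forall>x\<in>B. \<bar>dual_apply g x - dual_apply f x\<bar> < e) \<longrightarrow> P g))"
  (is "?L \<longleftrightarrow> ?R")
proof
  assume ?L
  then obtain S where "open S" "f \<in> S" "\<forall>g\<in>S. P g" by (auto simp: eventually_nhds)
  moreover from this obtain B e where "vn_bounded B" "0 < e"
      "{g. \<forall>x\<in>B. \<bar>dual_apply g x - dual_apply f x\<bar> < e} \<subseteq> S"
    unfolding open_dual_def by blast
  ultimately show ?R by (intro exI[of _ B] exI[of _ e]) auto
next
  assume ?R
  then obtain B e where B: "vn_bounded B" "0 < e"
      "\<forall>g. (\<forall>x\<in>B. \<bar>dual_apply g x - dual_apply f x\<bar> < e) \<longrightarrow> P g"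
    by blast
  obtain V where V: "open V" "f \<in> V"
      "\<And>g x. g \<in> V \<Longrightarrow> x \<in> B \<Longrightarrow> \<bar>dual_apply g x - dual_apply f x\<bar> < e"
    using dual_ball[OF B(1,2), of f] by metis
  have "\<forall>g\<in>V. P g" using V(3) B(3) by simp
  then show ?L unfolding eventually_nhds using V(1,2) by (intro exI[of _ V] conjI)
qed

lemma eventually_dual_ball:
  "vn_bounded B \<Longrightarrow> 0 < e \<Longrightarrow>
    eventually (\<lambda>g. \<forall>x\<in>B. \<bar>dual_apply g x - dual_apply f x\<bar> < e) (nhds f)"
  unfolding eventually_nhds_dual by blast

lemma vn_bounded_singleton: "vn_bounded {x :: 'a::locally_convex_space}"
  unfolding vn_bounded_def
proof
  fix U :: "'a set" assume "U \<in> neighbourhoods euclidean 0"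
  then obtain V where V: "open V" "0 \<in> V" "V \<subseteq> U" by (auto simp: neighbourhoods_def)
  have "((\<lambda>t. (t, x)) \<longlongrightarrow> (0, x)) (nhds (0::real))"
    by (intro tendsto_Pair tendsto_const filterlim_ident)
  then have "((\<lambda>t. t *\<^sub>R x) \<longlongrightarrow> 0 *\<^sub>R x) (nhds (0::real))"
    using filterlim_compose[OF tendsto_scaleR_lcs[of 0 x], of "\<lambda>t. (t, x)"]
    by (simp add: nhds_prod)
  then have "eventually (\<lambda>t. t *\<^sub>R x \<in> V) (nhds (0::real))"
    using V by (simp add: tendsto_def)
  then obtain d where d: "0 < d" "\<And>t. \<bar>t\<bar> < d \<Longrightarrow> t *\<^sub>R x \<in> V"
    by (auto simp: eventually_nhds_metric dist_real_def)
  show "absorbs U {x}"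
    unfolding absorbs_def
  proof (intro exI[of _ "2 / d"] conjI allI impI)
    show "0 < 2 / d" using d by simp
    fix t :: real assume t: "2 / d \<le> \<bar>t\<bar>"
    have "0 < 2 / d" using d by simp
    with t have "t \<noteq> 0" by auto
    have "2 \<le> \<bar>t\<bar> * d" using t d by (simp add: field_simps)
    then have "\<bar>inverse t\<bar> < d" using \<open>t \<noteq> 0\<close> by (simp add: abs_inverse field_simps)
    then have "inverse t *\<^sub>R x \<in> U" using d V by blast
    moreover have "x = t *\<^sub>R (inverse t *\<^sub>R x)" using \<open>t \<noteq> 0\<close> by simp
    ultimately show "{x} \<subseteq> (\<lambda>x. t *\<^sub>R x) ` U" by blast
  qed
qed

lemma continuous_on_dual_eval: "continuous_on UNIV (\<lambda>f. dual_apply f x)"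
proof -
  have "((\<lambda>f. dual_apply f x) \<longlongrightarrow> dual_apply f x) (nhds f)" for f
    unfolding tendsto_iff dist_real_def
    using eventually_dual_ball[OF vn_bounded_singleton[of x]] by simp
  then show ?thesis
    unfolding continuous_on_def at_within_def
    by (auto intro: tendsto_mono[OF inf_le1])
qed

lemma dual_apply_bounded_on:
  assumes "vn_bounded B"
  obtains M where "0 < M" "\<And>x. x \<in> B \<Longrightarrow> \<bar>dual_apply f x\<bar> \<le> M"
proof -
  let ?U = "dual_apply f -` {-1<..<1}"
  have "open ?U"
    by (rule open_vimage) (auto simp: continuous_on_dual_apply)
  moreover have "0 \<in> ?U"
    using linear_0[OF linear_dual_apply[of f]] by simp
  ultimately have "?U \<in> neighbourhoods euclidean 0"
    by (auto simp: neighbourhoods_def)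
  then obtain r where r: "0 < r" "\<forall>t. r \<le> \<bar>t\<bar> \<longrightarrow> B \<subseteq> (\<lambda>x. t *\<^sub>R x) ` ?U"
    using assms unfolding vn_bounded_def absorbs_def by blast
  have "\<bar>dual_apply f x\<bar> \<le> r" if "x \<in> B" for x
  proof -
    have "B \<subseteq> (\<lambda>x. r *\<^sub>R x) ` ?U" using r by simp
    with that have "x \<in> (\<lambda>x. r *\<^sub>R x) ` ?U" by (rule rev_subsetD)
    then obtain y where "x = r *\<^sub>R y" "y \<in> ?U" by (rule imageE)
    then have "dual_apply f x = r * dual_apply f y" "\<bar>dual_apply f y\<bar> \<le> 1"
      using linear_scale[OF linear_dual_apply[of f]] by auto
    then show ?thesis using r by (simp add: abs_mult mult_left_le)
  qed
  with r show ?thesis using that by blast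
qed

instance dual :: (locally_convex_space) locally_convex_space
proof
  fix f g :: "'a dual"
  show "filterlim (\<lambda>p. fst p + snd p) (nhds (f + g)) (nhds f \<times>\<^sub>F nhds g)"
    unfolding filterlim_iff
  proof (intro allI impI)
    fix P :: "'a dual \<Rightarrow> bool" assume "eventually P (nhds (f + g))"
    then obtain B e where B: "vn_bounded B" "0 < e"
        "\<And>h. (\<forall>x\<in>B. \<bar>dual_apply h x - dual_apply (f + g) x\<bar> < e) \<Longrightarrow> P h"
      unfolding eventually_nhds_dual by blast
    have "eventually (\<lambda>p. (\<forall>x\<in>B. \<bar>dual_apply (fst p) x - dual_apply f x\<bar> < e / 2) \<and>
        (\<forall>x\<in>B. \<bar>dual_apply (snd p) x - dual_apply g x\<bar> < e / 2)) (nhds f \<times>\<^sub>F nhds g)"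
      using eventually_dual_ball[OF B(1), of "e / 2"] B(2)
      by (intro eventually_prodI) auto
    then show "eventually (\<lambda>p. P (fst p + snd p)) (nhds f \<times>\<^sub>F nhds g)"
    proof eventually_elim
      case (elim p)
      show ?case
      proof (rule B(3), rule)
        fix x assume "x \<in> B"
        with elim have "\<bar>dual_apply (fst p) x - dual_apply f x\<bar> < e / 2"
          "\<bar>dual_apply (snd p) x - dual_apply g x\<bar> < e / 2" by auto
        then show "\<bar>dual_apply (fst p + snd p) x - dual_apply (f + g) x\<bar> < e"
          unfolding plus_dual.rep_eq by (rule abs_add_diff_half)
      qed
    qed
  qed
next
  fix f :: "'a dual"
  show "(uminus \<longlongrightarrow> - f) (nhds f)"
    unfolding filterlim_iff
  proof (intro allI impI)
    fix P :: "'a dual \<Rightarrow> bool" assume "eventually P (nhds (- f))"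
    then obtain B e where B: "vn_bounded B" "0 < e"
        "\<And>h. (\<forall>x\<in>B. \<bar>dual_apply h x - dual_apply (- f) x\<bar> < e) \<Longrightarrow> P h"
      unfolding eventually_nhds_dual by blast
    from eventually_dual_ball[OF B(1,2), of f]
    show "eventually (\<lambda>g. P (- g)) (nhds f)"
      by eventually_elim (auto intro!: B(3) simp: uminus_dual.rep_eq abs_minus_commute)
  qed
next
  fix f g :: "'a dual" assume "f \<noteq> g"
  then obtain x where "dual_apply f x \<noteq> dual_apply g x" using dual_eqI by blast
  then obtain U V where UV: "open U" "open V" "dual_apply f x \<in> U" "dual_apply g x \<in> V" "U \<inter> V = {}"
    using hausdorff by metis
  have "open ((\<lambda>f. dual_apply f x) -` U)" "open ((\<lambda>f. dual_apply f x) -` V)"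
    using UV by (auto intro!: open_vimage continuous_on_dual_eval)
  then show "\<exists>U V. open U \<and> open V \<and> f \<in> U \<and> g \<in> V \<and> U \<inter> V = {}"
    using UV by (intro exI[of _ "(\<lambda>f. dual_apply f x) -` U"] exI[of _ "(\<lambda>f. dual_apply f x) -` V"]) auto
next
  fix a :: real and f :: "'a dual"
  show "filterlim (\<lambda>p. fst p *\<^sub>R snd p) (nhds (a *\<^sub>R f)) (nhds a \<times>\<^sub>F nhds f)"
    unfolding filterlim_iff
  proof (intro allI impI)
    fix P :: "'a dual \<Rightarrow> bool" assume "eventually P (nhds (a *\<^sub>R f))"
    then obtain B e where B: "vn_bounded B" "0 < e"
        "\<And>h. (\<forall>x\<in>B. \<bar>dual_apply h x - dual_apply (a *\<^sub>R f) x\<bar> < e) \<Longrightarrow> P h"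
      unfolding eventually_nhds_dual by blast
    obtain M where M: "0 < M" "\<And>x. x \<in> B \<Longrightarrow> \<bar>dual_apply f x\<bar> \<le> M"
      using dual_apply_bounded_on[OF B(1)] by metis
    define d where "d = min 1 (e / (2 * M))"
    have d: "0 < d" "d \<le> 1" "d * M \<le> e / 2"
      using B(2) M(1) by (auto simp: d_def min_def field_simps)
    define c where "c = e / (2 * (\<bar>a\<bar> + 1))"
    have c: "0 < c" "(\<bar>a\<bar> + 1) * c = e / 2"
      using B(2) by (auto simp: c_def field_simps)
    have "eventually (\<lambda>r. \<bar>r - a\<bar> < d) (nhds a)"
      using d(1) by (auto simp: eventually_nhds_metric dist_real_def)
    then have "eventually (\<lambda>p. \<bar>fst p - a\<bar> < d \<and>
        (\<forall>x\<in>B. \<bar>dual_apply (snd p) x - dual_apply f x\<bar> < c)) (nhds a \<times>\<^sub>F nhds f)"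
      using eventually_dual_ball[OF B(1) c(1), of f] by (rule eventually_prodI)
    then show "eventually (\<lambda>p. P (fst p *\<^sub>R snd p)) (nhds a \<times>\<^sub>F nhds f)"
    proof eventually_elim
      case (elim p)
      show ?case
      proof (rule B(3), rule)
        fix x assume x: "x \<in> B"
        let ?r = "fst p" and ?h = "dual_apply (snd p) x" and ?f = "dual_apply f x"
        have "\<bar>?r\<bar> \<le> \<bar>a\<bar> + 1" using elim d(2) by linarith
        have "dual_apply (?r *\<^sub>R snd p) x - dual_apply (a *\<^sub>R f) x = ?r * (?h - ?f) + (?r - a) * ?f"
          by (simp add: scaleR_dual.rep_eq algebra_simps)
        also have "\<bar>\<dots>\<bar> \<le> \<bar>?r\<bar> * \<bar>?h - ?f\<bar> + \<bar>?r - a\<bar> * \<bar>?f\<bar>"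
          by (metis abs_mult abs_triangle_ineq)
        also have "\<dots> < (\<bar>a\<bar> + 1) * c + d * M"
        proof (rule add_less_le_mono)
          have "\<bar>?r\<bar> * \<bar>?h - ?f\<bar> \<le> (\<bar>a\<bar> + 1) * \<bar>?h - ?f\<bar>"
            using \<open>\<bar>?r\<bar> \<le> \<bar>a\<bar> + 1\<close> by (intro mult_right_mono) auto
          also have "\<dots> < (\<bar>a\<bar> + 1) * c"
            using elim x by (intro mult_strict_left_mono) auto
          finally show "\<bar>?r\<bar> * \<bar>?h - ?f\<bar> < (\<bar>a\<bar> + 1) * c" .
          show "\<bar>?r - a\<bar> * \<bar>?f\<bar> \<le> d * M"
            using elim M(2)[OF x] d(1) by (intro mult_mono) auto
        qed
        also have "\<dots> \<le> e" using c(2) d(3) by simp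
        finally show "\<bar>dual_apply (?r *\<^sub>R snd p) x - dual_apply (a *\<^sub>R f) x\<bar> < e" .
      qed
    qed
  qed
next
  fix U :: "'a dual set" and f assume "open U" "f \<in> U"
  then obtain B e where B: "vn_bounded B" "0 < e"
      "{g. \<forall>x\<in>B. \<bar>dual_apply g x - dual_apply f x\<bar> < e} \<subseteq> U"
    unfolding open_dual_def by blast
  obtain V where V: "open V" "f \<in> V" "convex V"
      "\<And>g x. g \<in> V \<Longrightarrow> x \<in> B \<Longrightarrow> \<bar>dual_apply g x - dual_apply f x\<bar> < e"
    using dual_ball[OF B(1,2), of f] by metis
  have "V \<subseteq> U" using V(4) B(3) by blast
  with V show "\<exists>V. open V \<and> f \<in> V \<and>
      (\<forall>a\<in>V. \<forall>b\<in>V. \<forall>u\<ge>0. \<forall>v\<ge>0. u + v = 1 \<longrightarrow> u *\<^sub>R a + v *\<^sub>R b \<in> V) \<and> V \<subseteq> U"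
    unfolding convex_def by blast
qed


section \<open>The canonical embedding into the bidual\<close>

(* 'a dual dual is the dual of the strong dual of 'a, again with its strong topology *)
lift_definition bidual_embedding :: "'a::locally_convex_space \<Rightarrow> 'a dual dual"
  is "\<lambda>x f. dual_apply f x"
  by (auto intro!: linearI continuous_on_dual_eval simp: plus_dual.rep_eq scaleR_dual.rep_eq)

definition bidual_closure :: "'a::locally_convex_space set \<Rightarrow> 'a dual dual set" where
  "bidual_closure C = closure (bidual_embedding ` C)"


section \<open>Denting points, points of continuity, extreme points\<close>

definition weak_topology :: "'a::locally_convex_space topology" where
  "weak_topology = topology_generated_by {dual_apply f -` V | f V. open V}"

definition DP :: "'a::locally_convex_space set \<Rightarrow> 'a set" where
  "DP C = {x \<in> C. \<forall>U \<in> neighbourhoods euclidean x. x \<notin> closure (convex hull (C - U))}"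

definition bDP :: "'a::locally_convex_space set \<Rightarrow> 'a set" where
  "bDP C = {x \<in> DP C. \<exists>W \<in> neighbourhoods weak_topology x. vn_bounded (W \<inter> C)}"

definition PC :: "'a::locally_convex_space set \<Rightarrow> 'a set" where
  "PC C = {x \<in> C. \<forall>U \<in> neighbourhoods euclidean x.
    \<exists>W \<in> neighbourhoods weak_topology x. W \<inter> C \<subseteq> U}"

definition bPC :: "'a::locally_convex_space set \<Rightarrow> 'a set" where
  "bPC C = {x \<in> PC C. \<exists>W \<in> neighbourhoods weak_topology x. vn_bounded (W \<inter> C)}"

definition ext :: "'a::real_vector set \<Rightarrow> 'a set" where
  "ext D = {x \<in> D. \<forall>d\<^sub>1\<in>D. \<forall>d\<^sub>2\<in>D. x = (1 / 2) *\<^sub>R (d\<^sub>1 + d\<^sub>2) \<longrightarrow> x = d\<^sub>1 \<and> x = d\<^sub>2}"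

end

theory Submission
  imports Defs
begin

text \<open>A denting point \<open>x\<close> is separated from \<open>conv (C - U)\<close> by a functional, that is, \<open>C\<close> has a
  slice around \<open>x\<close> inside \<open>U\<close>. Slices are weak neighbourhoods, so \<open>x\<close> is a point of continuity; if
  \<open>x\<close> is the midpoint of two points of the bidual closure, one of them lies in every given slice,
  hence both equal \<open>x\<close>.

  For the converse let \<open>D\<close> be the trace on \<open>C\<close> of a basic weak neighbourhood of \<open>x\<close>, chosen so small
  that \<open>D\<close> is bounded and contained in \<open>U\<close>. The part of \<open>D\<close> far from \<open>x\<close> is a finite union of convex
  sets \<open>A i\<close> with \<open>x \<notin> closure (A i)\<close>. A point of the convex hull of \<open>A \<union> B\<close> is the midpoint of a point
  of \<open>A\<close> or \<open>B\<close> and a point of \<open>D\<close>. If such midpoints \<open>(a + c) / 2\<close> converge to \<open>x\<close>, then along a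
  finer filter \<open>a\<close> and \<open>c\<close> converge pointwise on the dual, to \<open>P\<close> and \<open>Q\<close> say. Since \<open>x\<close> is a point of
  continuity and the canonical embedding is strongly continuous (infrabarreledness), both limits are
  strong, so \<open>P\<close> and \<open>Q\<close> lie in the bidual closure with midpoint \<open>x\<close>. Extremality gives \<open>P = x\<close>, so
  \<open>a\<close> tends weakly, hence in the original topology, to \<open>x\<close>, and \<open>x \<in> closure A\<close>. By induction \<open>x\<close> is not in
  the closed convex hull of all \<open>A i\<close>; a separating functional defines a slice of \<open>D\<close> that avoids
  every \<open>A i\<close>, and by convexity of \<open>C\<close> it is a slice of \<open>C\<close>.\<close>


section \<open>Separation in locally convex spaces\<close>

definition sublinear :: "('a::real_vector \<Rightarrow> real) \<Rightarrow> bool" where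
  "sublinear p \<longleftrightarrow> (\<forall>x y. p (x + y) \<le> p x + p y) \<and> (\<forall>t>0. \<forall>x. p (t *\<^sub>R x) = t * p x)"

text \<open>Applying the scaling inequality to \<open>inverse t\<close> gives the reverse inequality
  for \<open>t\<close>.\<close>

lemma sublinearI:
  assumes "\<And>x y. p (x + y) \<le> p x + p y"
    and "\<And>t x. 0 < t \<Longrightarrow> p (t *\<^sub>R x) \<le> t * p x"
  shows "sublinear p"
  unfolding sublinear_def
proof (intro conjI allI impI)
  fix t :: real and x assume t: "0 < t"
  have "t * p x = t * p (inverse t *\<^sub>R (t *\<^sub>R x))" using t by simp
  also have "\<dots> \<le> t * (inverse t * p (t *\<^sub>R x))"
    using t by (intro mult_left_mono assms(2)) auto
  also have "\<dots> = p (t *\<^sub>R x)" using t by simp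
  finally show "p (t *\<^sub>R x) = t * p x" using assms(2)[OF t] by (simp add: antisym)
qed (fact assms(1))

lemma sublinear_add: "sublinear p \<Longrightarrow> p (x + y) \<le> p x + p y"
  by (simp add: sublinear_def)

lemma sublinear_scale: "sublinear p \<Longrightarrow> 0 < t \<Longrightarrow> p (t *\<^sub>R x) = t * p x"
  by (simp add: sublinear_def)

lemma sublinear_zero: "sublinear p \<Longrightarrow> p 0 = 0"
  using sublinear_scale[of p 2 0] by simp

lemma sublinear_minus: "sublinear p \<Longrightarrow> - p (- x) \<le> p x"
  using sublinear_add[of p x "- x"] sublinear_zero[of p] by simp

text \<open>The infimum of \<open>p (z + t *\<^sub>R y) - t * p y\<close> over
  \<open>t \<ge> 0\<close> serves as \<open>q\<close>: \<open>t = 0\<close> gives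
  \<open>q \<le> p\<close>, and \<open>t = 1\<close> gives the other two bounds. Subadditivity
  bounds these values below by \<open>- p (- z)\<close>.\<close>

lemma sublinear_tilt:
  assumes p: "sublinear p"
  obtains q where "sublinear q" "q \<le> p" "\<And>z. q z \<le> p (z + y) - p y" "q (- y) \<le> - p y"
proof
  define S where "S z = (\<lambda>t. p (z + t *\<^sub>R y) - t * p y) ` {0..}" for z
  define q where "q z = Inf (S z)" for z
  have scale: "p (t *\<^sub>R z) = t * p z" if "0 \<le> t" for t z
    using that sublinear_scale[OF p] sublinear_zero[OF p] by (cases "t = 0") auto
  have lower: "- p (- z) \<le> p (z + t *\<^sub>R y) - t * p y" if "0 \<le> t" for z t
    using sublinear_add[OF p, of "z + t *\<^sub>R y" "- z"] scale[OF that, of y] by simp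
  have bdd: "bdd_below (S z)" for z
    unfolding S_def using lower by (intro bdd_belowI2[of _ "- p (- z)"]) auto
  have ne: "S z \<noteq> {}" for z by (simp add: S_def)
  have le: "q z \<le> p (z + t *\<^sub>R y) - t * p y" if "0 \<le> t" for z t
    unfolding q_def using that by (intro cInf_lower bdd) (auto simp: S_def)
  have ge: "c \<le> q z" if "\<And>t. 0 \<le> t \<Longrightarrow> c \<le> p (z + t *\<^sub>R y) - t * p y" for c z
    unfolding q_def using that ne by (intro cInf_greatest) (auto simp: S_def)
  show "sublinear q"
  proof (rule sublinearI)
    fix z w
    have *: "q (z + w) \<le> (p (z + s *\<^sub>R y) - s * p y) + (p (w + t *\<^sub>R y) - t * p y)"
      if "0 \<le> s" "0 \<le> t" for s t
      using le[of "s + t" "z + w"] that sublinear_add[OF p, of "z + s *\<^sub>R y" "w + t *\<^sub>R y"]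
      by (simp add: algebra_simps)
    have "q (z + w) - q w \<le> q z"
    proof (rule ge)
      fix s :: real assume s: "0 \<le> s"
      have "q (z + w) - (p (z + s *\<^sub>R y) - s * p y) \<le> q w"
        using *[OF s] by (intro ge) (simp add: algebra_simps)
      then show "q (z + w) - q w \<le> p (z + s *\<^sub>R y) - s * p y" by simp
    qed
    then show "q (z + w) \<le> q z + q w" by simp
  next
    fix s :: real and z assume s: "0 < s"
    have "q (s *\<^sub>R z) / s \<le> q z"
    proof (rule ge)
      fix t :: real assume t: "0 \<le> t"
      have "q (s *\<^sub>R z) \<le> p (s *\<^sub>R z + (s * t) *\<^sub>R y) - s * t * p y"
        using s t by (intro le) simp
      also have "s *\<^sub>R z + (s * t) *\<^sub>R y = s *\<^sub>R (z + t *\<^sub>R y)" by (simp add: algebra_simps)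
      also have "p \<dots> = s * p (z + t *\<^sub>R y)" using s by (intro scale) simp
      finally show "q (s *\<^sub>R z) / s \<le> p (z + t *\<^sub>R y) - t * p y"
        using s by (simp add: field_simps)
    qed
    then show "q (s *\<^sub>R z) \<le> s * q z" using s by (simp add: field_simps)
  qed
  show "q \<le> p" using le[of 0] by (simp add: le_fun_def)
  show "q z \<le> p (z + y) - p y" for z using le[of 1 z] by simp
  show "q (- y) \<le> - p y" using le[of 1 "- y"] sublinear_zero[OF p] by simp
qed

text \<open>Supplies the lower bounds for Zorn's lemma. In a sum \<open>q x + r y\<close> both
  members of the chain can be replaced by the smaller one, so subadditivity survives the infimum;
  the common bound \<open>p\<close> keeps the infimum finite.\<close>

lemma sublinear_chain_Inf:
  assumes ne: "C \<noteq> {}" and sub: "\<And>q. q \<in> C \<Longrightarrow> sublinear q \<and> q \<le> p"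
    and chain: "\<And>q r. q \<in> C \<Longrightarrow> r \<in> C \<Longrightarrow> q \<le> r \<or> r \<le> q"
  shows "sublinear (\<lambda>x. INF q\<in>C. q x)" "\<And>q. q \<in> C \<Longrightarrow> (\<lambda>x. INF q\<in>C. q x) \<le> q"
proof -
  have bdd: "bdd_below ((\<lambda>q. q x) ` C)" for x
  proof (intro bdd_belowI2)
    fix q assume "q \<in> C"
    then have "sublinear q" "q (- x) \<le> p (- x)" using sub by (auto simp: le_fun_def)
    then show "- p (- x) \<le> q x" using sublinear_minus[of q x] by linarith
  qed
  have le: "(INF q\<in>C. q x) \<le> q x" if "q \<in> C" for q x
    using that by (intro cINF_lower bdd)
  show "(\<lambda>x. INF q\<in>C. q x) \<le> q" if "q \<in> C" for q using le[OF that] by (simp add: le_fun_def)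
  show "sublinear (\<lambda>x. INF q\<in>C. q x)"
  proof (rule sublinearI)
    fix x y
    have *: "(INF q\<in>C. q (x + y)) \<le> q x + r y" if qr: "q \<in> C" "r \<in> C" for q r
    proof -
      obtain s where s: "s \<in> C" "s \<le> q" "s \<le> r" using chain[OF qr] qr by blast
      have "(INF q\<in>C. q (x + y)) \<le> s x + s y"
        using le[OF s(1), of "x + y"] sublinear_add[of s x y] sub[OF s(1)] by linarith
      also have "\<dots> \<le> q x + r y" using s by (intro add_mono) (auto simp: le_fun_def)
      finally show ?thesis .
    qed
    have "(INF q\<in>C. q (x + y)) - (INF q\<in>C. q y) \<le> (INF q\<in>C. q x)"
    proof (rule cINF_greatest[OF ne])
      fix q assume q: "q \<in> C"
      have "(INF q\<in>C. q (x + y)) - q x \<le> (INF q\<in>C. q y)"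
        using *[OF q] by (intro cINF_greatest[OF ne]) (simp add: diff_le_eq add.commute)
      then show "(INF q\<in>C. q (x + y)) - (INF q\<in>C. q y) \<le> q x" by simp
    qed
    then show "(INF q\<in>C. q (x + y)) \<le> (INF q\<in>C. q x) + (INF q\<in>C. q y)" by simp
  next
    fix t :: real and x assume t: "0 < t"
    have "(INF q\<in>C. q (t *\<^sub>R x)) / t \<le> (INF q\<in>C. q x)"
    proof (rule cINF_greatest[OF ne])
      fix q assume q: "q \<in> C"
      have "(INF q\<in>C. q (t *\<^sub>R x)) \<le> t * q x"
        using le[OF q, of "t *\<^sub>R x"] sublinear_scale[of q t x] sub[OF q] t by simp
      then show "(INF q\<in>C. q (t *\<^sub>R x)) / t \<le> q x" using t by (simp add: field_simps)
    qed
    then show "(INF q\<in>C. q (t *\<^sub>R x)) \<le> t * (INF q\<in>C. q x)" using t by (simp add: field_simps)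
  qed
qed

text \<open>A minimal sublinear functional equals its tilt in every direction, which forces additivity.\<close>

lemma sublinear_dominates_linear:
  assumes p: "sublinear p"
  obtains f where "linear f" "f \<le> p"
proof -
  define A where "A = {q. sublinear q \<and> q \<le> p}"
  \<comment> \<open>Zorn's lemma for the reversed pointwise order: a maximal element is a minimal
    sublinear functional below \<open>p\<close>.\<close>
  have "\<exists>m\<in>A. \<forall>a\<in>A. m \<ge> a \<longrightarrow> a = m"
  proof (rule predicate_Zorn)
    show "partial_order_on A (relation_of (\<ge>) A)"
      by (rule partial_order_on_relation_ofI) auto
    fix C assume C: "C \<in> Chains (relation_of (\<ge>) A)"
    show "\<exists>u\<in>A. \<forall>a\<in>C. a \<ge> u"
    proof (cases "C = {}")
      case True
      then show ?thesis using p by (auto simp: A_def)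
    next
      case False
      have sub: "sublinear q \<and> q \<le> p" if "q \<in> C" for q
        using C that by (auto simp: Chains_def relation_of_def A_def)
      have chain: "q \<le> r \<or> r \<le> q" if "q \<in> C" "r \<in> C" for q r
        using C that by (auto simp: Chains_def relation_of_def)
      note inf = sublinear_chain_Inf[OF False sub chain]
      obtain q where "q \<in> C" using False by blast
      then have "(\<lambda>x. INF q\<in>C. q x) \<le> p"
        using inf(2) sub order_trans by blast
      then show ?thesis using inf by (intro bexI[of _ "\<lambda>x. INF q\<in>C. q x"]) (auto simp: A_def)
    qed
  qed
  then obtain f where f: "sublinear f" "f \<le> p"
    and min: "\<And>q. sublinear q \<Longrightarrow> q \<le> p \<Longrightarrow> q \<le> f \<Longrightarrow> q = f"
    by (auto simp: A_def)
  have add: "f (x + y) = f x + f y" for x y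
  proof -
    obtain q where q: "sublinear q" "q \<le> f" "\<And>z. q z \<le> f (z + y) - f y"
      using sublinear_tilt[OF f(1), of y] by metis
    then have "q = f" using min f(2) order_trans by blast
    with q(3)[of x] sublinear_add[OF f(1), of x y] show ?thesis by simp
  qed
  \<comment> \<open>Oddness extends homogeneity from positive to negative scalars.\<close>
  have neg: "f (- x) = - f x" for x
    using add[of x "- x"] sublinear_zero[OF f(1)] by simp
  have "f (t *\<^sub>R x) = t * f x" for t x
  proof (cases "0 < t" "t = 0" rule: bool.exhaust[case_product bool.exhaust])
    case False_False
    then have "f ((- t) *\<^sub>R x) = (- t) * f x" by (intro sublinear_scale f(1)) simp
    then show ?thesis using neg[of "t *\<^sub>R x"] by simp
  qed (use sublinear_zero[OF f(1)] sublinear_scale[OF f(1)] in auto)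
  then have "linear f" using add by (intro linearI) auto
  with f(2) that show ?thesis by blast
qed

text \<open>A linear \<open>f\<close> below the tilt of \<open>p\<close> at \<open>y\<close>
  satisfies \<open>f (- y) \<le> - p y\<close>, that is \<open>p y \<le> f y\<close>; the reverse
  inequality comes from \<open>q \<le> p\<close>.\<close>

lemma Hahn_Banach_supporting:
  assumes p: "sublinear p"
  obtains f where "linear f" "f \<le> p" "f y = p y"
proof -
  obtain q where q: "sublinear q" "q \<le> p" "q (- y) \<le> - p y"
    using sublinear_tilt[OF p, of y] by metis
  obtain f where f: "linear f" "f \<le> q"
    using sublinear_dominates_linear[OF q(1)] by metis
  have "f (- y) \<le> q (- y)" using f(2) by (simp add: le_fun_def)
  then have "p y \<le> f y" using q(3) linear_neg[OF f(1), of y] by simp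
  moreover have fp: "f \<le> p" using f(2) q(2) by (rule order_trans)
  ultimately have "f y = p y" by (simp add: le_fun_def antisym)
  with f(1) fp that show ?thesis by blast
qed

text \<open>\<open>f\<close> lies below the Minkowski gauge \<open>p\<close> of \<open>G\<close> and
  touches it at \<open>x\<close>. Absorption makes the gauge finite, and \<open>x \<notin> G\<close>
  forces \<open>1 \<le> p x\<close>.\<close>

lemma supporting_functional:
  fixes G :: "'a::real_vector set"
  assumes G: "convex G" "0 \<in> G" and absorb: "\<And>z. \<exists>t>0. (1 / t) *\<^sub>R z \<in> G" and x: "x \<notin> G"
  obtains f :: "'a \<Rightarrow> real" where "linear f" "\<And>z. z \<in> G \<Longrightarrow> f z \<le> 1" "1 \<le> f x"
proof -
  define S where "S z = {t. 0 < t \<and> (1 / t) *\<^sub>R z \<in> G}" for z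
  define p where "p z = Inf (S z)" for z
  have bdd: "bdd_below (S z)" for z by (intro bdd_belowI[of _ 0]) (auto simp: S_def)
  have ne: "S z \<noteq> {}" for z using absorb[of z] by (auto simp: S_def)
  have le: "p z \<le> t" if "0 < t" "(1 / t) *\<^sub>R z \<in> G" for t z
    unfolding p_def using that by (intro cInf_lower bdd) (auto simp: S_def)
  have ge: "c \<le> p z" if "\<And>t. 0 < t \<Longrightarrow> (1 / t) *\<^sub>R z \<in> G \<Longrightarrow> c \<le> t" for c z
    unfolding p_def using that ne by (intro cInf_greatest) (auto simp: S_def)
  have "sublinear p"
  proof (rule sublinearI)
    fix z w
    have *: "p (z + w) \<le> s + t"
      if st: "0 < s" "0 < t" "(1 / s) *\<^sub>R z \<in> G" "(1 / t) *\<^sub>R w \<in> G" for s t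
    proof (rule le)
      have "(s / (s + t)) *\<^sub>R ((1 / s) *\<^sub>R z) + (t / (s + t)) *\<^sub>R ((1 / t) *\<^sub>R w) \<in> G"
        using st by (intro convexD[OF G(1)]) (auto simp: add_divide_distrib[symmetric])
      then show "(1 / (s + t)) *\<^sub>R (z + w) \<in> G" using st by (simp add: scaleR_add_right)
    qed (use st in simp)
    have "p (z + w) - p w \<le> p z"
    proof (rule ge)
      fix s :: real assume s: "0 < s" "(1 / s) *\<^sub>R z \<in> G"
      have "p (z + w) - s \<le> p w" using *[OF s(1) _ s(2)] by (intro ge) (simp add: algebra_simps)
      then show "p (z + w) - p w \<le> s" by simp
    qed
    then show "p (z + w) \<le> p z + p w" by simp
  next
    fix s :: real and z assume s: "0 < s"
    have "p (s *\<^sub>R z) / s \<le> p z"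
    proof (rule ge)
      fix t :: real assume t: "0 < t" "(1 / t) *\<^sub>R z \<in> G"
      have "p (s *\<^sub>R z) \<le> s * t" using s t by (intro le) auto
      then show "p (s *\<^sub>R z) / s \<le> t" using s by (simp add: field_simps)
    qed
    then show "p (s *\<^sub>R z) \<le> s * p z" using s by (simp add: field_simps)
  qed
  then obtain f where f: "linear f" "f \<le> p" "f x = p x"
    using Hahn_Banach_supporting[of p x] by metis
  have "1 \<le> p x"
  proof (rule ge, rule ccontr)
    fix t :: real assume t: "0 < t" "(1 / t) *\<^sub>R x \<in> G" "\<not> 1 \<le> t"
    \<comment> \<open>For \<open>t < 1\<close> the point \<open>x\<close> lies on the segment from
      \<open>0\<close> to \<open>(1 / t) *\<^sub>R x\<close>, inside \<open>G\<close>.\<close>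
    have "t *\<^sub>R ((1 / t) *\<^sub>R x) + (1 - t) *\<^sub>R 0 \<in> G"
      using t G(2) by (intro convexD[OF G(1)]) auto
    with t x show False by simp
  qed
  moreover have "f z \<le> 1" if "z \<in> G" for z
    using f(2) le[of 1 z] that by (auto simp: le_fun_def intro: order_trans)
  ultimately show ?thesis using that f by simp
qed

section \<open>Continuity of linear functionals and separation\<close>

lemma tendsto_scaleR_locally_convex:
  fixes g :: "'b \<Rightarrow> 'a::locally_convex_space"
  assumes "(f \<longlongrightarrow> a) F" "(g \<longlongrightarrow> x) F"
  shows "((\<lambda>z. f z *\<^sub>R g z) \<longlongrightarrow> a *\<^sub>R x) F"
proof -
  have "filterlim (\<lambda>z. (f z, g z)) (nhds a \<times>\<^sub>F nhds x) F"
    using assms by (intro filterlim_Pair)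
  from filterlim_compose[OF tendsto_scaleR_lcs this] show ?thesis by simp
qed

lemma continuous_on_scaleR_locally_convex:
  fixes g :: "'b::topological_space \<Rightarrow> 'a::locally_convex_space"
  assumes "continuous_on S f" "continuous_on S g"
  shows "continuous_on S (\<lambda>z. f z *\<^sub>R g z)"
  using assms unfolding continuous_on_def by (auto intro: tendsto_scaleR_locally_convex)

lemma continuous_linear_if_bounded_near_0:
  fixes f :: "'a::locally_convex_space \<Rightarrow> real"
  assumes f: "linear f" and V: "open V" "0 \<in> V" and bound: "\<And>v. v \<in> V \<Longrightarrow> \<bar>f v\<bar> \<le> 1"
  shows "continuous_on UNIV f"
proof -
  have "(f \<longlongrightarrow> f y) (nhds y)" for y
    unfolding tendsto_iff dist_real_def
  proof (intro allI impI)
    fix e :: real assume e: "0 < e"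
    \<comment> \<open>The factor \<open>2 / e\<close> turns the non-strict bound 1 on
      \<open>V\<close> into a deviation of at most \<open>e / 2\<close>, strictly below
      \<open>e\<close>.\<close>
    have "continuous_on UNIV (\<lambda>z. (2 / e) *\<^sub>R (z - y))"
      by (intro continuous_on_scaleR_locally_convex continuous_intros)
    then have "open ((\<lambda>z. (2 / e) *\<^sub>R (z - y)) -` V)" using V by (intro open_vimage)
    then have "eventually (\<lambda>z. z \<in> (\<lambda>z. (2 / e) *\<^sub>R (z - y)) -` V) (nhds y)"
      using V by (intro eventually_nhds_in_open) auto
    then show "eventually (\<lambda>z. \<bar>f z - f y\<bar> < e) (nhds y)"
    proof eventually_elim
      case (elim z)
      then have "\<bar>f ((2 / e) *\<^sub>R (z - y))\<bar> \<le> 1" using bound by simp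
      moreover have "\<bar>f ((2 / e) *\<^sub>R (z - y))\<bar> = (2 / e) * \<bar>f z - f y\<bar>"
        unfolding linear_scale[OF f] linear_diff[OF f] real_scaleR_def abs_mult using e by simp
      ultimately have "2 * \<bar>f z - f y\<bar> \<le> e" using e by (simp add: pos_divide_le_eq)
      then show ?case using e by simp
    qed
  qed
  then show ?thesis
    unfolding continuous_on_def at_within_def by (auto intro: tendsto_mono[OF inf_le1])
qed

lemma scaled_into_open:
  fixes z :: "'a::locally_convex_space"
  assumes "open V" "0 \<in> V"
  obtains t where "0 < t" "(1 / t) *\<^sub>R z \<in> V"
proof -
  have "((\<lambda>t. t *\<^sub>R z) \<longlongrightarrow> 0 *\<^sub>R z) (at_right (0::real))"
    by (intro tendsto_scaleR_locally_convex tendsto_const tendsto_ident_at)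
  then have "eventually (\<lambda>t. t *\<^sub>R z \<in> V) (at_right (0::real))"
    using assms by (simp add: tendsto_def)
  moreover have "eventually (\<lambda>t::real. 0 < t) (at_right 0)" by (simp add: eventually_at_right_less)
  ultimately have "eventually (\<lambda>t. 0 < t \<and> t *\<^sub>R z \<in> V) (at_right (0::real))"
    by (rule eventually_conj[rotated])
  then obtain t :: real where "0 < t" "t *\<^sub>R z \<in> V"
    using eventually_happens'[OF trivial_limit_at_right_real] by blast
  then show ?thesis by (intro that[of "1 / t"]) auto
qed

text \<open>Thickening \<open>K - k0\<close> by a convex symmetric neighbourhood \<open>V\<close> of
  0 such that \<open>x - V\<close> misses \<open>K\<close> gives a convex neighbourhood
  \<open>G\<close> of 0 that omits \<open>x - k0\<close>. The functional supporting \<open>G\<close>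
  is bounded on \<open>V\<close>, hence continuous.\<close>

lemma separation_closure_convex:
  fixes K :: "'a::locally_convex_space set"
  assumes K: "convex K" and x: "x \<notin> closure K"
  obtains f \<alpha> where "\<alpha> < dual_apply f x" "\<And>k. k \<in> K \<Longrightarrow> dual_apply f k \<le> \<alpha>"
proof (cases "K = {}")
  case True
  then show ?thesis by (intro that[of "dual_apply 0 x - 1" 0]) auto
next
  case False
  then obtain k0 where k0: "k0 \<in> K" by blast
  have "open ((\<lambda>v. x - v) -` (- closure K))"
    by (intro open_vimage open_Compl closed_closure continuous_intros)
  then obtain V0 where V0: "open V0" "0 \<in> V0"
      "\<forall>a\<in>V0. \<forall>b\<in>V0. \<forall>u\<ge>0. \<forall>v\<ge>0. u + v = 1 \<longrightarrow> u *\<^sub>R a + v *\<^sub>R b \<in> V0"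
      "V0 \<subseteq> (\<lambda>v. x - v) -` (- closure K)"
    using convex_nhds_base[of "(\<lambda>v. x - v) -` (- closure K)" 0] x by auto
  \<comment> \<open>Symmetry turns the bound \<open>f \<le> 1\<close> on \<open>V\<close> into
    \<open>\<bar>f\<bar> \<le> 1\<close>.\<close>
  define V where "V = V0 \<inter> uminus -` V0"
  have V: "open V" "0 \<in> V" "convex V" "\<And>v. v \<in> V \<Longrightarrow> - v \<in> V"
    using V0(1-2) by (auto simp: V_def intro!: open_Int open_vimage continuous_intros)
      (use V0(3) in \<open>force simp: convex_def\<close>)
  have disj: "x - v \<notin> K" if "v \<in> V" for v
    using that V0(4) closure_subset[of K] by (auto simp: V_def)
  define G where "G = (\<Union>k\<in>(\<lambda>k. k - k0) ` K. \<Union>v\<in>V. {k + v})"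
  have GI: "k - k0 + v \<in> G" if "k \<in> K" "v \<in> V" for k v
    using that by (auto simp: G_def)
  have "convex G"
    unfolding G_def by (intro convex_sums V(3) convex_translation_subtract K)
  moreover have VG: "V \<subseteq> G" using GI[OF k0] by auto
  moreover have "x - k0 \<notin> G"
  proof
    assume "x - k0 \<in> G"
    then obtain k v where kv: "k \<in> K" "v \<in> V" "x - k0 = k - k0 + v" by (auto simp: G_def)
    then have "x - v = k" by (simp add: algebra_simps)
    with kv disj show False by blast
  qed
  moreover have "\<exists>t>0. (1 / t) *\<^sub>R z \<in> G" for z
    using scaled_into_open[OF V(1,2), of z] VG by blast
  ultimately obtain f :: "'a \<Rightarrow> real" where f: "linear f" "\<And>z. z \<in> G \<Longrightarrow> f z \<le> 1" "1 \<le> f (x - k0)"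
    using supporting_functional[of G "x - k0"] V(2) by blast
  have "\<bar>f v\<bar> \<le> 1" if "v \<in> V" for v
    using f(2)[of v] f(2)[of "- v"] V(4)[OF that] that VG linear_neg[OF f(1), of v]
    by (auto simp: abs_le_iff)
  then have "continuous_on UNIV f"
    by (intro continuous_linear_if_bounded_near_0[OF f(1) V(1,2)])
  then have D: "dual_apply (Dual f) = f" using f(1) by (simp add: Dual_inverse)
  \<comment> \<open>A positive multiple of \<open>x - k0\<close> in \<open>V\<close> produces the
    strict gap: shifting \<open>K - k0\<close> by it stays in \<open>G\<close>, so on
    \<open>K\<close> the functional is below \<open>f x\<close> by at least
    \<open>f (x - k0) / t\<close>.\<close>
  obtain t where t: "0 < t" "(1 / t) *\<^sub>R (x - k0) \<in> V"
    using scaled_into_open[OF V(1,2)] by metis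
  show ?thesis
  proof (rule that[of "f x - f (x - k0) / t" "Dual f"])
    show "f x - f (x - k0) / t < dual_apply (Dual f) x" using t f(3) by (simp add: D)
    fix k assume "k \<in> K"
    then have "f (k - k0 + (1 / t) *\<^sub>R (x - k0)) \<le> 1" using GI t(2) f(2) by blast
    then show "dual_apply (Dual f) k \<le> f x - f (x - k0) / t"
      using f(3) unfolding linear_add[OF f(1)] linear_diff[OF f(1)] linear_scale[OF f(1)] D by simp
  qed
qed


section \<open>Denting points and slices\<close>

lemma neighbourhoods_euclidean_iff:
  "U \<in> neighbourhoods euclidean x \<longleftrightarrow> (\<exists>V. open V \<and> x \<in> V \<and> V \<subseteq> U)"
  by (simp add: neighbourhoods_def)

lemma open_in_neighbourhoods: "open U \<Longrightarrow> x \<in> U \<Longrightarrow> U \<in> neighbourhoods euclidean x"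
  by (auto simp: neighbourhoods_euclidean_iff)

lemma weak_neighbourhood_basic:
  assumes "W \<in> neighbourhoods weak_topology x"
  obtains \<Phi> e where "finite \<Phi>" "0 < e"
    "{y. \<forall>f\<in>\<Phi>. \<bar>dual_apply f y - dual_apply f x\<bar> < e} \<subseteq> W"
proof -
  define basic where "basic V \<longleftrightarrow> (\<exists>\<Phi> e. finite \<Phi> \<and> 0 < e \<and>
      {y. \<forall>f\<in>\<Phi>. \<bar>dual_apply f y - dual_apply f x\<bar> < e} \<subseteq> V)" for V
  obtain V where V: "openin weak_topology V" "x \<in> V" "V \<subseteq> W"
    using assms by (auto simp: neighbourhoods_def)
  have "generate_topology_on {dual_apply f -` V | f V. open V} V"
    using V(1) by (simp add: weak_topology_def openin_topology_generated_by_iff)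
  \<comment> \<open>The guard \<open>x \<in> V\<close> is there because sets arising in the
    generation of the topology may omit \<open>x\<close>.\<close>
  then have "x \<in> V \<longrightarrow> basic V"
  proof induction
    case (Int a b)
    show ?case
    proof
      assume "x \<in> a \<inter> b"
      with Int.IH have ab: "basic a" "basic b" by auto
      obtain A d where A: "finite A" "0 < d"
          "{y. \<forall>f\<in>A. \<bar>dual_apply f y - dual_apply f x\<bar> < d} \<subseteq> a"
        using ab(1) unfolding basic_def by blast
      obtain B e where B: "finite B" "0 < e"
          "{y. \<forall>f\<in>B. \<bar>dual_apply f y - dual_apply f x\<bar> < e} \<subseteq> b"
        using ab(2) unfolding basic_def by blast
      have "{y. \<forall>f\<in>A \<union> B. \<bar>dual_apply f y - dual_apply f x\<bar> < min d e} \<subseteq> a \<inter> b"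
        using A(3) B(3) by auto
      then show "basic (a \<inter> b)"
        unfolding basic_def using A B by (intro exI[of _ "A \<union> B"] exI[of _ "min d e"]) auto
    qed
  next
    case (UN K)
    show ?case
    proof
      assume "x \<in> \<Union> K"
      then obtain k where "k \<in> K" "basic k" using UN.IH by blast
      then show "basic (\<Union> K)" unfolding basic_def by (meson Union_upper subset_trans)
    qed
  next
    case (Basis s)
    then obtain f V where s: "s = dual_apply f -` V" "open V" by blast
    show ?case
    proof
      assume "x \<in> s"
      then obtain e where "0 < e" "\<And>r. \<bar>r - dual_apply f x\<bar> < e \<Longrightarrow> r \<in> V"
        using s by (auto simp: open_dist dist_real_def)
      then show "basic s"
        unfolding basic_def using s by (intro exI[of _ "{f}"] exI[of _ e]) auto
    qed
  qed simp
  with V(2) obtain \<Phi> e where "finite \<Phi>" "0 < e"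
      "{y. \<forall>f\<in>\<Phi>. \<bar>dual_apply f y - dual_apply f x\<bar> < e} \<subseteq> V"
    unfolding basic_def by blast
  then show ?thesis using that V(3) by blast
qed

lemma half_space_in_weak_neighbourhoods:
  assumes "\<alpha> < dual_apply f x"
  shows "{y. \<alpha> < dual_apply f y} \<in> neighbourhoods weak_topology x"
proof -
  have "openin weak_topology (dual_apply f -` {\<alpha><..})"
    unfolding weak_topology_def by (rule topology_generated_by_Basis) (use open_greaterThan in blast)
  moreover have "dual_apply f -` {\<alpha><..} = {y. \<alpha> < dual_apply f y}" by auto
  ultimately show ?thesis using assms by (auto simp: neighbourhoods_def)
qed

lemma convex_half_space: "convex {y. dual_apply f y \<le> \<alpha>}"
proof -
  have "{y. dual_apply f y \<le> \<alpha>} = dual_apply f -` {..\<alpha>}" by auto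
  then show ?thesis by (simp add: convex_linear_vimage linear_dual_apply)
qed

lemma closed_half_space: "closed {y. dual_apply f y \<le> \<alpha>}"
  by (intro closed_Collect_le continuous_on_dual_apply continuous_on_const)

text \<open>A functional separating \<open>x\<close> from the hull gives the slice. Conversely,
  \<open>f \<le> \<alpha>\<close> describes a closed convex set that contains \<open>C - U\<close>
  and misses \<open>x\<close>.\<close>

lemma DP_iff_slices:
  "x \<in> DP C \<longleftrightarrow> x \<in> C \<and> (\<forall>U\<in>neighbourhoods euclidean x.
    \<exists>f \<alpha>. \<alpha> < dual_apply f x \<and> (\<forall>c\<in>C. \<alpha> < dual_apply f c \<longrightarrow> c \<in> U))"
proof -
  have "x \<notin> closure (convex hull (C - U)) \<longleftrightarrow>
      (\<exists>f \<alpha>. \<alpha> < dual_apply f x \<and> (\<forall>c\<in>C. \<alpha> < dual_apply f c \<longrightarrow> c \<in> U))" for U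
  proof
    assume "x \<notin> closure (convex hull (C - U))"
    then obtain f \<alpha> where f: "\<alpha> < dual_apply f x"
        "\<And>k. k \<in> convex hull (C - U) \<Longrightarrow> dual_apply f k \<le> \<alpha>"
      using separation_closure_convex[OF convex_convex_hull] by metis
    have "c \<in> U" if "c \<in> C" "\<alpha> < dual_apply f c" for c
      using f(2)[OF hull_inc, of c] that by force
    with f(1) show "\<exists>f \<alpha>. \<alpha> < dual_apply f x \<and> (\<forall>c\<in>C. \<alpha> < dual_apply f c \<longrightarrow> c \<in> U)"
      by blast
  next
    assume "\<exists>f \<alpha>. \<alpha> < dual_apply f x \<and> (\<forall>c\<in>C. \<alpha> < dual_apply f c \<longrightarrow> c \<in> U)"
    then obtain f \<alpha> where f: "\<alpha> < dual_apply f x" "\<And>c. c \<in> C \<Longrightarrow> \<alpha> < dual_apply f c \<Longrightarrow> c \<in> U"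
      by blast
    have "closure (convex hull (C - U)) \<subseteq> {y. dual_apply f y \<le> \<alpha>}"
      using f(2) by (intro closure_minimal hull_minimal convex_half_space closed_half_space) force
    with f(1) show "x \<notin> closure (convex hull (C - U))" by auto
  qed
  then show ?thesis by (simp add: DP_def)
qed

lemma DP_subset_PC: "DP C \<subseteq> PC C"
proof
  fix x assume x: "x \<in> DP C"
  show "x \<in> PC C"
    unfolding PC_def
  proof (intro CollectI conjI ballI)
    show "x \<in> C" using x by (simp add: DP_def)
    fix U assume "U \<in> neighbourhoods euclidean x"
    then obtain f \<alpha> where "\<alpha> < dual_apply f x" "\<forall>c\<in>C. \<alpha> < dual_apply f c \<longrightarrow> c \<in> U"
      using x by (auto simp: DP_iff_slices)
    then show "\<exists>W\<in>neighbourhoods weak_topology x. W \<inter> C \<subseteq> U"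
      by (intro bexI[OF _ half_space_in_weak_neighbourhoods]) auto
  qed
qed

lemma bidual_embedding_apply: "dual_apply (bidual_embedding x) f = dual_apply f x"
  by (simp add: bidual_embedding.rep_eq)

lemma bidual_embedding_in_bidual_closure: "x \<in> C \<Longrightarrow> bidual_embedding x \<in> bidual_closure C"
  unfolding bidual_closure_def by (intro subsetD[OF closure_subset] imageI)

lemma bidual_embedding_eq_midpoint_iff:
  "bidual_embedding x = (1 / 2) *\<^sub>R (d + e) \<longleftrightarrow>
    (\<forall>f. dual_apply d f + dual_apply e f = 2 * dual_apply f x)"
  by (auto simp: dual_apply_inject[symmetric] fun_eq_iff bidual_embedding_apply
      plus_dual.rep_eq scaleR_dual.rep_eq field_simps)

text \<open>Of two points of the bidual closure with midpoint \<open>x\<close>, one lies in a given slice around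
  \<open>x\<close>; a functional separating the two points keeps it away from \<open>x\<close>.\<close>

lemma DP_imp_ext_bidual_closure:
  assumes x: "x \<in> DP C"
  shows "bidual_embedding x \<in> ext (bidual_closure C)"
proof -
  have eq: "d = e" if de: "d \<in> bidual_closure C" "e \<in> bidual_closure C"
    and mid: "\<And>f. dual_apply d f + dual_apply e f = 2 * dual_apply f x" for d e
  proof (rule ccontr)
    assume "d \<noteq> e"
    then obtain h where h: "dual_apply d h \<noteq> dual_apply e h" using dual_eqI by blast
    \<comment> \<open>\<open>d\<close> and \<open>e\<close> lie symmetrically about
      \<open>x\<close>, so under \<open>h\<close> both deviate from \<open>x\<close> by
      \<open>2 * r\<close>; a slice on which \<open>h\<close> deviates by less than \<open>r\<close>
      stays away from both.\<close>
    define r where "r = \<bar>dual_apply d h - dual_apply h x\<bar> / 2"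
    have "dual_apply e h - dual_apply h x = - (dual_apply d h - dual_apply h x)"
      using mid[of h] by simp
    then have e: "\<bar>dual_apply e h - dual_apply h x\<bar> = \<bar>dual_apply d h - dual_apply h x\<bar>"
      by (simp only: abs_minus_cancel)
    have r: "0 < r" using h mid[of h] by (simp add: r_def)
    have rd: "r < \<bar>dual_apply d h - dual_apply h x\<bar>"
      using r by (simp add: r_def)
    then have re: "r < \<bar>dual_apply e h - dual_apply h x\<bar>" by (simp only: e)
    have "open {y. \<bar>dual_apply h y - dual_apply h x\<bar> < r}"
      by (intro open_Collect_less continuous_intros continuous_on_dual_apply)
    then have "{y. \<bar>dual_apply h y - dual_apply h x\<bar> < r} \<in> neighbourhoods euclidean x"
      using r by (intro open_in_neighbourhoods) auto
    then obtain f \<alpha> where f: "\<alpha> < dual_apply f x"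
        "\<forall>c\<in>C. \<alpha> < dual_apply f c \<longrightarrow> \<bar>dual_apply h c - dual_apply h x\<bar> < r"
      using x by (auto simp: DP_iff_slices)
    define N where "N = {P. \<alpha> < dual_apply P f} \<inter> {P. r < \<bar>dual_apply P h - dual_apply h x\<bar>}"
    have N: "open N"
      unfolding N_def
      by (intro open_Int open_Collect_less continuous_intros continuous_on_dual_eval)
    \<comment> \<open>The values of \<open>d\<close> and \<open>e\<close> at \<open>f\<close> have
      mean \<open>dual_apply f x\<close>, so one of them exceeds \<open>\<alpha>\<close>.\<close>
    have "d \<in> N \<or> e \<in> N" using mid[of f] f(1) rd re unfolding N_def by auto
    then have "N \<inter> closure (bidual_embedding ` C) \<noteq> {}" using de by (auto simp: bidual_closure_def)
    then have "N \<inter> bidual_embedding ` C \<noteq> {}" using open_Int_closure_eq_empty[OF N] by blast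
    then show False using f(2) by (force simp: N_def bidual_embedding_apply)
  qed
  show ?thesis
    unfolding ext_def
  proof (intro CollectI conjI[OF _ ballI[OF ballI[OF impI]]])
    show "bidual_embedding x \<in> bidual_closure C"
      using x by (auto simp: DP_def intro: bidual_embedding_in_bidual_closure)
    fix d e assume de: "d \<in> bidual_closure C" "e \<in> bidual_closure C"
      and mid: "bidual_embedding x = (1 / 2) *\<^sub>R (d + e)"
    have "d = e" using eq[OF de] mid by (simp add: bidual_embedding_eq_midpoint_iff)
    with mid show "bidual_embedding x = d \<and> bidual_embedding x = e"
      by (simp add: scaleR_2[symmetric])
  qed
qed

section \<open>Strong continuity of the canonical embedding\<close>

text \<open>This scaled polar of a strongly bounded set is a barrel absorbing all bounded sets,
  which is where infrabarreledness enters.\<close>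

lemma polar_in_neighbourhoods:
  fixes B :: "'a::locally_convex_space dual set"
  assumes E: "infrabarreled TYPE('a)" and B: "vn_bounded B" and e: "0 < e"
  shows "{y. \<forall>f\<in>B. \<bar>dual_apply f y\<bar> \<le> e} \<in> neighbourhoods euclidean 0"
proof -
  define P where "P = {y. \<forall>f\<in>B. \<bar>dual_apply f y\<bar> \<le> e}"
  have "absorbs P S" if S: "vn_bounded S" for S
  proof -
    \<comment> \<open>Absorbing \<open>B\<close> into a strong neighbourhood of functionals below 1
      on \<open>S\<close> bounds all of \<open>B\<close> on \<open>S\<close> by a single constant
      \<open>r\<close>.\<close>
    obtain V :: "'a dual set" where V: "open V" "0 \<in> V"
        "\<And>g x. g \<in> V \<Longrightarrow> x \<in> S \<Longrightarrow> \<bar>dual_apply g x - dual_apply 0 x\<bar> < 1"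
      using dual_ball[OF S zero_less_one, of 0] by metis
    then obtain r where r: "0 < r" "B \<subseteq> (\<lambda>f. r *\<^sub>R f) ` V"
      using B open_in_neighbourhoods[OF V(1,2)] unfolding vn_bounded_def absorbs_def by force
    have bound: "\<bar>dual_apply f x\<bar> \<le> r" if "f \<in> B" "x \<in> S" for f x
    proof -
      obtain g where g: "g \<in> V" "f = r *\<^sub>R g" using r(2) \<open>f \<in> B\<close> by blast
      then have "\<bar>dual_apply g x\<bar> \<le> 1" using V(3)[OF g(1) that(2)] by (simp add: zero_dual.rep_eq)
      then show ?thesis using g(2) r(1) by (simp add: scaleR_dual.rep_eq abs_mult mult_left_le)
    qed
    show ?thesis
      unfolding absorbs_def
    proof (intro exI[of _ "r / e"] conjI allI impI subsetI)
      show re: "0 < r / e" using r e by simp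
      fix t x assume t: "r / e \<le> \<bar>t\<bar>" and x: "x \<in> S"
      have t0: "t \<noteq> 0" using re t by auto
      have "\<bar>dual_apply f (inverse t *\<^sub>R x)\<bar> \<le> e" if "f \<in> B" for f
      proof -
        have "\<bar>dual_apply f x\<bar> \<le> e * \<bar>t\<bar>"
          using bound[OF that x] t e by (simp add: field_simps)
        then show ?thesis
          using t0 by (simp add: linear_scale[OF linear_dual_apply] abs_mult abs_inverse field_simps)
      qed
      then have "inverse t *\<^sub>R x \<in> P" by (simp add: P_def)
      moreover have "x = t *\<^sub>R (inverse t *\<^sub>R x)" using t0 by simp
      ultimately show "x \<in> (\<lambda>x. t *\<^sub>R x) ` P" by blast
    qed
  qed
  note absorbs = this
  have P_Int: "P = (\<Inter>f\<in>B. {y. \<bar>dual_apply f y\<bar> \<le> e})" by (auto simp: P_def)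
  have "closed P"
    unfolding P_Int
    by (intro closed_INT ballI closed_Collect_le continuous_intros continuous_on_dual_apply)
  moreover have "convex P"
  proof -
    have "{y. \<bar>dual_apply f y\<bar> \<le> e} = dual_apply f -` {-e..e}" for f :: "'a dual" by auto
    then show ?thesis
      unfolding P_Int by (simp add: convex_INT convex_linear_vimage linear_dual_apply)
  qed
  moreover have "balanced P"
    unfolding balanced_def
  proof (intro allI impI subsetI)
    fix t :: real and z assume t: "\<bar>t\<bar> \<le> 1" and "z \<in> (\<lambda>x. t *\<^sub>R x) ` P"
    then obtain y where y: "y \<in> P" "z = t *\<^sub>R y" by blast
    have "\<bar>dual_apply f z\<bar> \<le> e" if "f \<in> B" for f
    proof -
      have "\<bar>dual_apply f z\<bar> = \<bar>t\<bar> * \<bar>dual_apply f y\<bar>"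
        by (simp add: y(2) linear_scale[OF linear_dual_apply] abs_mult)
      also have "\<dots> \<le> \<bar>dual_apply f y\<bar>" using t by (intro mult_left_le_one_le) auto
      also have "\<dots> \<le> e" using y(1) that by (simp add: P_def)
      finally show ?thesis .
    qed
    then show "z \<in> P" by (simp add: P_def)
  qed
  moreover have "absorbent P" unfolding absorbent_def using absorbs vn_bounded_singleton by blast
  ultimately have "barrel P" by (simp add: barrel_def)
  with E absorbs have "P \<in> neighbourhoods euclidean 0" by (simp add: infrabarreled_def)
  then show ?thesis by (simp add: P_def)
qed

lemma translated_polar_in_neighbourhoods:
  fixes B :: "'a::locally_convex_space dual set"
  assumes "infrabarreled TYPE('a)" "vn_bounded B" "0 < e"
  shows "{y. \<forall>f\<in>B. \<bar>dual_apply f y - dual_apply f x\<bar> \<le> e} \<in> neighbourhoods euclidean x"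
proof -
  obtain V where V: "open V" "0 \<in> V" "V \<subseteq> {y. \<forall>f\<in>B. \<bar>dual_apply f y\<bar> \<le> e}"
    using polar_in_neighbourhoods[OF assms] by (auto simp: neighbourhoods_euclidean_iff)
  have "open ((\<lambda>y. y - x) -` V)" by (intro open_vimage V continuous_intros)
  moreover have "(\<lambda>y. y - x) -` V \<subseteq> {y. \<forall>f\<in>B. \<bar>dual_apply f y - dual_apply f x\<bar> \<le> e}"
  proof (intro subsetI CollectI ballI)
    fix y f assume "y \<in> (\<lambda>y. y - x) -` V" "f \<in> B"
    then have "\<bar>dual_apply f (y - x)\<bar> \<le> e" using V(3) by blast
    then show "\<bar>dual_apply f y - dual_apply f x\<bar> \<le> e" by (simp add: linear_diff[OF linear_dual_apply])
  qed
  ultimately show ?thesis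
    using V(2) unfolding neighbourhoods_euclidean_iff by (intro exI[of _ "(\<lambda>y. y - x) -` V"]) simp
qed


section \<open>Weak limits of midpoints\<close>

text \<open>Functionals bounded by 1 on \<open>D\<close> have limits bounded by 1. Boundedness of
  \<open>D\<close> provides a strong neighbourhood of 0 made of such functionals, so the pointwise
  limit is strongly continuous.\<close>

lemma pointwise_limit_in_bidual:
  fixes a :: "'b \<Rightarrow> 'a::locally_convex_space"
  assumes F: "F \<noteq> bot" and D: "vn_bounded D" "eventually (\<lambda>z. a z \<in> D) F"
    and lim: "\<And>f. ((\<lambda>z. dual_apply f (a z)) \<longlongrightarrow> p f) F"
  obtains P where "dual_apply P = p"
proof -
  have linear: "linear p"
  proof (rule linearI)
    fix f g :: "'a dual" and r :: real
    have "((\<lambda>z. dual_apply (f + g) (a z)) \<longlongrightarrow> p f + p g) F"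
      unfolding plus_dual.rep_eq by (intro tendsto_add lim)
    then show "p (f + g) = p f + p g" using tendsto_unique[OF F lim] by blast
    have "((\<lambda>z. dual_apply (r *\<^sub>R f) (a z)) \<longlongrightarrow> r *\<^sub>R p f) F"
      unfolding scaleR_dual.rep_eq by (intro tendsto_scaleR tendsto_const lim)
    then show "p (r *\<^sub>R f) = r *\<^sub>R p f" using tendsto_unique[OF F lim] by blast
  qed
  obtain V :: "'a dual set" where V: "open V" "0 \<in> V"
      "\<And>g x. g \<in> V \<Longrightarrow> x \<in> D \<Longrightarrow> \<bar>dual_apply g x - dual_apply 0 x\<bar> < 1"
    using dual_ball[OF D(1) zero_less_one, of 0] by metis
  have "\<bar>p g\<bar> \<le> 1" if "g \<in> V" for g
  proof (rule tendsto_upperbound[OF tendsto_rabs[OF lim] _ F])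
    from D(2) show "eventually (\<lambda>z. \<bar>dual_apply g (a z)\<bar> \<le> 1) F"
      by eventually_elim (use V(3)[OF that] in \<open>force simp: zero_dual.rep_eq\<close>)
  qed
  then have "continuous_on UNIV p"
    by (intro continuous_linear_if_bounded_near_0[OF linear V(1,2)])
  with linear that show ?thesis by (metis (mono_tags) CollectI Dual_inverse)
qed

text \<open>The midpoint of \<open>a z\<close> and \<open>c w\<close> for independent \<open>z\<close> and \<open>w\<close> is weakly close to \<open>x\<close>, hence
  close to \<open>x\<close> because \<open>x\<close> is a point of continuity. Letting only \<open>w\<close> tend to its limit shows
  that \<open>a z\<close> is strongly close to \<open>P\<close>.\<close>

lemma weak_midpoint_limit_in_bidual_closure:
  fixes a c :: "'b \<Rightarrow> 'a::locally_convex_space"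
  assumes E: "infrabarreled TYPE('a)" and D: "convex D" and x: "x \<in> PC D" and F: "F \<noteq> bot"
    and aD: "eventually (\<lambda>z. a z \<in> D) F" and cD: "eventually (\<lambda>z. c z \<in> D) F"
    and limP: "\<And>f. ((\<lambda>z. dual_apply f (a z)) \<longlongrightarrow> dual_apply P f) F"
    and limQ: "\<And>f. ((\<lambda>z. dual_apply f (c z)) \<longlongrightarrow> dual_apply Q f) F"
    and mid: "\<And>f. dual_apply P f + dual_apply Q f = 2 * dual_apply f x"
  shows "P \<in> bidual_closure D"
proof -
  have meets: "U \<inter> bidual_embedding ` D \<noteq> {}" if U: "open U" "P \<in> U" for U
  proof -
    obtain B e where B: "vn_bounded B" "0 < e"
        "{G. \<forall>f\<in>B. \<bar>dual_apply G f - dual_apply P f\<bar> < e} \<subseteq> U"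
      using U unfolding open_dual_def by blast
    \<comment> \<open>Passing from the midpoint to the sum doubles the tolerance to
      \<open>2 * e / 3\<close>, which survives the limit in \<open>w\<close> and is still below
      \<open>e\<close>.\<close>
    have "{y. \<forall>f\<in>B. \<bar>dual_apply f y - dual_apply f x\<bar> \<le> e / 3} \<in> neighbourhoods euclidean x"
      using B(2) by (intro translated_polar_in_neighbourhoods[OF E B(1)]) simp
    then obtain W where W: "W \<in> neighbourhoods weak_topology x"
        "W \<inter> D \<subseteq> {y. \<forall>f\<in>B. \<bar>dual_apply f y - dual_apply f x\<bar> \<le> e / 3}"
      using x unfolding PC_def by blast
    obtain \<Phi> d where \<Phi>: "finite \<Phi>" "0 < d"
        "{y. \<forall>f\<in>\<Phi>. \<bar>dual_apply f y - dual_apply f x\<bar> < d} \<subseteq> W"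
      using weak_neighbourhood_basic[OF W(1)] by blast
    define T where "T z \<longleftrightarrow> a z \<in> D \<and> c z \<in> D \<and> (\<forall>f\<in>\<Phi>.
        \<bar>dual_apply f (a z) - dual_apply P f\<bar> < d \<and> \<bar>dual_apply f (c z) - dual_apply Q f\<bar> < d)" for z
    have "eventually (\<lambda>z. \<forall>f\<in>\<Phi>.
        \<bar>dual_apply f (a z) - dual_apply P f\<bar> < d \<and> \<bar>dual_apply f (c z) - dual_apply Q f\<bar> < d) F"
      using limP limQ \<Phi>(2) unfolding tendsto_iff dist_real_def
      by (intro eventually_ball_finite[OF \<Phi>(1)] ballI eventually_conj) auto
    with aD cD have T: "eventually T F" unfolding T_def by eventually_elim simp
    then obtain z where z: "T z" using eventually_happens'[OF F] by blast
    have "\<bar>dual_apply f (a z) - dual_apply P f\<bar> < e" if f: "f \<in> B" for f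
    proof -
      have "\<bar>dual_apply f (a z) + dual_apply f (c w) - 2 * dual_apply f x\<bar> \<le> 2 * e / 3" if w: "T w" for w
      proof -
        let ?y = "(1 / 2) *\<^sub>R a z + (1 / 2) *\<^sub>R c w"
        have y: "dual_apply g ?y = (dual_apply g (a z) + dual_apply g (c w)) / 2" for g
          by (simp add: linear_add[OF linear_dual_apply] linear_scale[OF linear_dual_apply] field_simps)
        have "?y \<in> D" using z w by (intro convexD[OF D]) (auto simp: T_def)
        moreover have "\<bar>dual_apply g ?y - dual_apply g x\<bar> < d" if "g \<in> \<Phi>" for g
        proof -
          have "\<bar>dual_apply g (a z) - dual_apply P g\<bar> < d" "\<bar>dual_apply g (c w) - dual_apply Q g\<bar> < d"
            using z w that by (auto simp: T_def)
          \<comment> \<open>By \<open>mid\<close> the deviation of the midpoint is the mean of two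
            errors below \<open>d\<close>.\<close>
          then show ?thesis using mid[of g] unfolding y by (simp add: abs_less_iff field_simps)
        qed
        ultimately have "\<bar>dual_apply f ?y - dual_apply f x\<bar> \<le> e / 3" using W(2) \<Phi>(3) f by blast
        then show ?thesis unfolding y by (simp add: abs_le_iff field_simps)
      qed
      then have "eventually (\<lambda>w.
          \<bar>dual_apply f (a z) + dual_apply f (c w) - 2 * dual_apply f x\<bar> \<le> 2 * e / 3) F"
        by (rule eventually_mono[OF T])
      moreover have "((\<lambda>w. \<bar>dual_apply f (a z) + dual_apply f (c w) - 2 * dual_apply f x\<bar>) \<longlongrightarrow>
          \<bar>dual_apply f (a z) + dual_apply Q f - 2 * dual_apply f x\<bar>) F"
        by (intro tendsto_intros limQ)
      ultimately have "\<bar>dual_apply f (a z) + dual_apply Q f - 2 * dual_apply f x\<bar> \<le> 2 * e / 3"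
        using F by (intro tendsto_upperbound) auto
      moreover have "dual_apply f (a z) + dual_apply Q f - 2 * dual_apply f x =
          dual_apply f (a z) - dual_apply P f"
        using mid[of f] by simp
      ultimately have "\<bar>dual_apply f (a z) - dual_apply P f\<bar> \<le> 2 * e / 3" by simp
      also have "\<dots> < e" using B(2) by simp
      finally show ?thesis .
    qed
    then have "bidual_embedding (a z) \<in> U" using B(3) by (auto simp: bidual_embedding_apply)
    then show ?thesis using z by (auto simp: T_def)
  qed
  show ?thesis
    unfolding bidual_closure_def
  proof (rule ccontr)
    assume "P \<notin> closure (bidual_embedding ` D)"
    then have "- closure (bidual_embedding ` D) \<inter> bidual_embedding ` D \<noteq> {}"
      by (intro meets) auto
    then show False using closure_subset[of "bidual_embedding ` D"] by auto
  qed
qed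

text \<open>This plays the role of the Banach-Alaoglu theorem.\<close>

lemma weakly_convergent_refinement:
  fixes a :: "'b \<Rightarrow> 'a::locally_convex_space"
  assumes F: "F \<noteq> bot" and D: "vn_bounded D" "eventually (\<lambda>z. a z \<in> D) F"
  obtains G p where "G \<noteq> bot" "G \<le> F" "\<And>f. ((\<lambda>z. dual_apply f (a z)) \<longlongrightarrow> p f) G"
proof -
  have "\<exists>M. \<forall>x\<in>D. \<bar>dual_apply f x\<bar> \<le> M" for f
    using dual_apply_bounded_on[OF D(1), of f] by metis
  then obtain M where M: "\<And>f x. x \<in> D \<Longrightarrow> \<bar>dual_apply f x\<bar> \<le> M f" by metis
  \<comment> \<open>A product of compact intervals, compact by Tychonoff's theorem, containing the
    evaluations at all points of \<open>D\<close>.\<close>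
  define K where "K = PiE UNIV (\<lambda>f. {- M f..M f})"
  define \<phi> where "\<phi> z = (\<lambda>f. dual_apply f (a z))" for z
  have "compactin (product_topology (\<lambda>_. euclidean) UNIV) K"
    unfolding K_def compactin_PiE by (simp add: compactin_euclidean_iff)
  then have "compact K" by (simp add: euclidean_product_topology compactin_euclidean_iff)
  moreover have "filtermap \<phi> F \<noteq> bot" using F by (simp add: filtermap_bot_iff)
  moreover have "eventually (\<lambda>q. q \<in> K) (filtermap \<phi> F)"
    unfolding eventually_filtermap using D(2)
  proof eventually_elim
    case (elim z)
    have "- M f \<le> dual_apply f (a z) \<and> dual_apply f (a z) \<le> M f" for f
      using M[OF elim, of f] by (simp add: abs_le_iff)
    then show ?case by (simp add: K_def \<phi>_def PiE_iff)
  qed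
  ultimately obtain p where p: "inf (nhds p) (filtermap \<phi> F) \<noteq> bot"
    unfolding compact_filter by blast
  \<comment> \<open>\<open>p\<close> is only a cluster point of \<open>\<phi>\<close> along
    \<open>F\<close>; meeting \<open>F\<close> with the pulled-back neighbourhood filter of
    \<open>p\<close> gives a finer filter along which \<open>\<phi>\<close> converges.\<close>
  define G where "G = inf (filtercomap \<phi> (nhds p)) F"
  have "G \<noteq> bot"
  proof
    assume "G = bot"
    then have "eventually (\<lambda>_. False) G" by simp
    then obtain R Q where R: "eventually R (nhds p)" and Q: "eventually Q F"
      and RQ: "\<And>z. R (\<phi> z) \<Longrightarrow> \<not> Q z"
      unfolding G_def eventually_inf eventually_filtercomap by metis
    have "eventually (\<lambda>q. \<not> R q) (filtermap \<phi> F)"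
      unfolding eventually_filtermap using Q by eventually_elim (use RQ in blast)
    with R have "eventually (\<lambda>_. False) (inf (nhds p) (filtermap \<phi> F))"
      unfolding eventually_inf by blast
    with p show False by (simp add: trivial_limit_def)
  qed
  moreover have "G \<le> F" by (simp add: G_def)
  moreover have "((\<lambda>z. dual_apply f (a z)) \<longlongrightarrow> p f) G" for f
  proof -
    have "filterlim \<phi> (nhds p) G"
      unfolding G_def by (rule filterlim_mono[OF filterlim_filtercomap order_refl inf_le1])
    from continuous_on_tendsto_compose[OF continuous_on_product_coordinates[of f] this]
    have "((\<lambda>z. \<phi> z f) \<longlongrightarrow> p f) G" by simp
    then show ?thesis by (simp add: \<phi>_def)
  qed
  ultimately show ?thesis by (rule that)
qed

definition midpoints :: "'a::real_vector set \<Rightarrow> 'a set \<Rightarrow> 'a set" where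
  "midpoints A D = {(1 / 2) *\<^sub>R (a + c) | a c. a \<in> A \<and> c \<in> D}"

lemma in_closure_if_in_closure_midpoints:
  fixes D :: "'a::locally_convex_space set"
  assumes E: "infrabarreled TYPE('a)" and D: "convex D" "vn_bounded D" and x: "x \<in> PC D"
    and ext: "bidual_embedding x \<in> ext (bidual_closure D)"
    and A: "A \<subseteq> D" and xA: "x \<in> closure (midpoints A D)"
  shows "x \<in> closure A"
proof -
  define m where "m = (\<lambda>z. (1 / 2) *\<^sub>R (fst z + snd z) :: 'a)"
  \<comment> \<open>Pairs from \<open>A \<times> D\<close> whose midpoint tends to \<open>x\<close>;
    the filter is proper because \<open>x\<close> is in the closure of the midpoints.\<close>
  define F where "F = inf (filtercomap m (nhds x)) (principal (A \<times> D))"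
  have "F \<noteq> bot"
  proof
    assume "F = bot"
    then have "eventually (\<lambda>_. False) F" by simp
    then obtain R where R: "eventually R (nhds x)" "\<And>z. R (m z) \<Longrightarrow> z \<notin> A \<times> D"
      unfolding F_def eventually_inf_principal eventually_filtercomap by blast
    obtain U where U: "open U" "x \<in> U" "\<And>y. y \<in> U \<Longrightarrow> R y"
      using R(1) unfolding eventually_nhds by blast
    have "U \<inter> midpoints A D = {}" using U(3) R(2) by (force simp: midpoints_def m_def)
    then show False using open_Int_closure_eq_empty[OF U(1)] U(2) xA by blast
  qed
  moreover have AD: "eventually (\<lambda>z. fst z \<in> A \<and> snd z \<in> D) F"
    unfolding F_def eventually_inf_principal by (auto simp: mem_Times_iff)
  then have "eventually (\<lambda>z. fst z \<in> D) F" by eventually_elim (use A in blast)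
  ultimately obtain G p where G: "G \<noteq> bot" "G \<le> F"
      and p: "\<And>f. ((\<lambda>z. dual_apply f (fst z)) \<longlongrightarrow> p f) G"
    using weakly_convergent_refinement[OF _ D(2)] by metis
  have AD: "eventually (\<lambda>z. fst z \<in> A \<and> snd z \<in> D) G" using filter_leD[OF G(2) AD] .
  then have fstA: "eventually (\<lambda>z. fst z \<in> A) G" and sndD: "eventually (\<lambda>z. snd z \<in> D) G"
    by (auto simp: eventually_conj_iff)
  then have fstD: "eventually (\<lambda>z. fst z \<in> D) G" using A by (auto elim: eventually_mono)
  have "filterlim m (nhds x) G"
    using G(2) unfolding F_def
    by (intro filterlim_mono[OF filterlim_filtercomap order_refl]) auto
  then have m: "((\<lambda>z. dual_apply f (m z)) \<longlongrightarrow> dual_apply f x) G" for f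
    by (intro continuous_on_tendsto_compose[OF continuous_on_dual_apply]) auto
  \<comment> \<open>Once the first components converge, the convergence of the midpoints to
    \<open>x\<close> determines the limit of the second components.\<close>
  have "((\<lambda>z. dual_apply f (snd z)) \<longlongrightarrow> 2 * dual_apply f x - p f) G" for f
  proof -
    have "((\<lambda>z. 2 * dual_apply f (m z) - dual_apply f (fst z)) \<longlongrightarrow> 2 * dual_apply f x - p f) G"
      by (intro tendsto_intros m p)
    moreover have "2 * dual_apply f (m z) - dual_apply f (fst z) = dual_apply f (snd z)" for z
      by (simp add: m_def linear_add[OF linear_dual_apply] linear_scale[OF linear_dual_apply]
          add_divide_distrib)
    ultimately show ?thesis by simp
  qed
  note q = this
  obtain P where P: "dual_apply P = p" using pointwise_limit_in_bidual[OF G(1) D(2) fstD p] .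
  obtain Q where Q: "dual_apply Q = (\<lambda>f. 2 * dual_apply f x - p f)"
    using pointwise_limit_in_bidual[OF G(1) D(2) sndD q] .
  have PD: "P \<in> bidual_closure D"
    by (rule weak_midpoint_limit_in_bidual_closure[OF E D(1) x G(1) fstD sndD, where Q = Q])
      (use p q in \<open>simp_all add: P Q\<close>)
  moreover have QD: "Q \<in> bidual_closure D"
    by (rule weak_midpoint_limit_in_bidual_closure[OF E D(1) x G(1) sndD fstD, where Q = P])
      (use p q in \<open>simp_all add: P Q\<close>)
  moreover have "bidual_embedding x = (1 / 2) *\<^sub>R (P + Q)"
    by (simp add: bidual_embedding_eq_midpoint_iff P Q)
  ultimately have "bidual_embedding x = P" using ext unfolding ext_def by blast
  then have lim: "((\<lambda>z. dual_apply f (fst z)) \<longlongrightarrow> dual_apply f x) G" for f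
    using p[of f] P by (metis bidual_embedding_apply)
  have "U \<inter> A \<noteq> {}" if U: "open U" "x \<in> U" for U
  proof -
    obtain W where W: "W \<in> neighbourhoods weak_topology x" "W \<inter> D \<subseteq> U"
      using x open_in_neighbourhoods[OF U] unfolding PC_def by blast
    obtain \<Phi> d where \<Phi>: "finite \<Phi>" "0 < d"
        "{y. \<forall>f\<in>\<Phi>. \<bar>dual_apply f y - dual_apply f x\<bar> < d} \<subseteq> W"
      using weak_neighbourhood_basic[OF W(1)] by blast
    have "eventually (\<lambda>z. \<forall>f\<in>\<Phi>. \<bar>dual_apply f (fst z) - dual_apply f x\<bar> < d) G"
      using lim \<Phi>(2) unfolding tendsto_iff dist_real_def
      by (intro eventually_ball_finite[OF \<Phi>(1)]) auto
    with fstA have "eventually (\<lambda>z. fst z \<in> U \<inter> A) G"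
      by eventually_elim (use \<Phi>(3) W(2) A in blast)
    then show ?thesis using eventually_happens'[OF G(1)] by blast
  qed
  note meets = this
  show ?thesis
  proof (rule ccontr)
    assume "x \<notin> closure A"
    then have "- closure A \<inter> A \<noteq> {}" by (intro meets) auto
    then show False using closure_subset[of A] by auto
  qed
qed



section \<open>Slices around extreme points of continuity\<close>

text \<open>In \<open>u *\<^sub>R a + v *\<^sub>R b\<close> one weight is at least 1/2. Splitting
  off half of the total weight at that end leaves half of a convex combination of \<open>a\<close>
  and \<open>b\<close>, a point of \<open>D\<close>.\<close>

lemma convex_hull_Un_subset_midpoints:
  assumes D: "convex D" and A: "convex A" "A \<noteq> {}" "A \<subseteq> D" and B: "convex B" "B \<noteq> {}" "B \<subseteq> D"
  shows "convex hull (A \<union> B) \<subseteq> midpoints A D \<union> midpoints B D"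
proof
  \<comment> \<open>Indexing the two sets by truth values brings the union into the form of
    \<open>convex_hull_finite_union\<close>.\<close>
  define S where "S i = (if i then A else B)" for i
  have "\<Union> (range S) = A \<union> B" by (auto simp: S_def)
  moreover fix y assume "y \<in> convex hull (A \<union> B)"
  ultimately have "y \<in> convex hull (\<Union> (range S))" by simp
  also have "\<dots> = {\<Sum>i\<in>UNIV. c i *\<^sub>R s i | c s.
      (\<forall>i\<in>UNIV. 0 \<le> c i) \<and> sum c UNIV = 1 \<and> (\<forall>i\<in>UNIV. s i \<in> S i)}"
    using A B by (intro convex_hull_finite_union) (auto simp: S_def)
  finally obtain c s where c: "\<forall>i. 0 \<le> c i" "sum c UNIV = 1" and s: "\<forall>i. s i \<in> S i"
    and y: "y = (\<Sum>i\<in>UNIV. c i *\<^sub>R s i)" by auto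
  define a b u v where "a = s True" "b = s False" "u = c True" "v = c False"
  have ab: "a \<in> A" "b \<in> B" using s[rule_format, of True] s[rule_format, of False]
    by (simp_all add: a_b_u_v_def S_def)
  have uv: "0 \<le> u" "0 \<le> v" "u + v = 1" and y: "y = u *\<^sub>R a + v *\<^sub>R b"
    using c y by (simp_all add: UNIV_bool a_b_u_v_def add.commute)
  have *: "r *\<^sub>R z + t *\<^sub>R w \<in> midpoints T D"
    if "T \<subseteq> D" "z \<in> T" "w \<in> D" "1 / 2 \<le> r" "0 \<le> t" "r + t = 1" for r t :: real and z w T
  proof -
    have "(2 * r - 1) *\<^sub>R z + (2 * t) *\<^sub>R w \<in> D"
      using that by (intro convexD[OF D]) auto
    moreover have "r *\<^sub>R z + t *\<^sub>R w = (1 / 2) *\<^sub>R (z + ((2 * r - 1) *\<^sub>R z + (2 * t) *\<^sub>R w))"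
      by (simp add: algebra_simps)
    ultimately show ?thesis using that(2) unfolding midpoints_def by blast
  qed
  show "y \<in> midpoints A D \<union> midpoints B D"
  proof (cases "1 / 2 \<le> u")
    case True
    then show ?thesis using *[of A a b u v] A B ab uv y by auto
  next
    case False
    then show ?thesis using *[of B b a v u] A B ab uv y by (auto simp: add.commute)
  qed
qed

text \<open>One set is added at a time. The closure of a union of two sets is the union of their
  closures, so a failure would put \<open>x\<close> in the closure of one of two midpoint sets,
  hence in the closure of \<open>A i\<close> or of the earlier hull.\<close>

lemma notin_closure_convex_hull_Union:
  fixes D :: "'a::locally_convex_space set"
  assumes E: "infrabarreled TYPE('a)" and D: "convex D" "vn_bounded D" and x: "x \<in> PC D"
    and ext: "bidual_embedding x \<in> ext (bidual_closure D)"
    and I: "finite I" "\<And>i. i \<in> I \<Longrightarrow> convex (A i) \<and> A i \<subseteq> D \<and> x \<notin> closure (A i)"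
  shows "x \<notin> closure (convex hull (\<Union>i\<in>I. A i))"
  using I
proof (induction I)
  case (insert i I)
  define H where "H = convex hull (\<Union>i\<in>I. A i)"
  have H: "x \<notin> closure H" using insert by (simp add: H_def)
  have HD: "H \<subseteq> D" unfolding H_def using insert.prems D(1) by (intro hull_minimal) auto
  have Ai: "convex (A i)" "A i \<subseteq> D" "x \<notin> closure (A i)" using insert.prems by auto
  have eq: "convex hull (\<Union>i\<in>insert i I. A i) = convex hull (A i \<union> H)"
    unfolding H_def by (metis UN_insert hull_Un_right)
  show ?case
  \<comment> \<open>The midpoint inclusion is for nonempty sets; if one is empty, the hull is the
    other set.\<close>
  proof (cases "A i = {} \<or> H = {}")
    case True
    then have "convex hull (A i \<union> H) = H \<or> convex hull (A i \<union> H) = A i"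
      using Ai(1) by (auto simp: H_def hull_hull hull_same)
    then show ?thesis using H Ai(3) unfolding eq by auto
  next
    case False
    have "convex hull (A i \<union> H) \<subseteq> midpoints (A i) D \<union> midpoints H D"
      using False Ai HD by (intro convex_hull_Un_subset_midpoints D) (auto simp: H_def)
    then have "closure (convex hull (A i \<union> H)) \<subseteq> closure (midpoints (A i) D) \<union> closure (midpoints H D)"
      by (metis closure_Un closure_mono)
    moreover have "x \<notin> closure (midpoints (A i) D)" "x \<notin> closure (midpoints H D)"
      using in_closure_if_in_closure_midpoints[OF E D x ext] Ai H HD by blast+
    ultimately show ?thesis unfolding eq by blast
  qed
qed simp

section \<open>Passage from \<open>C\<close> to a small bounded subset\<close>

lemma ext_subset: "x \<in> ext D \<Longrightarrow> x \<in> D' \<Longrightarrow> D' \<subseteq> D \<Longrightarrow> x \<in> ext D'"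
  by (auto simp: ext_def)

lemma PC_subset: "x \<in> PC C \<Longrightarrow> x \<in> D \<Longrightarrow> D \<subseteq> C \<Longrightarrow> x \<in> PC D"
  unfolding PC_def by blast

lemma vn_bounded_subset: "vn_bounded B \<Longrightarrow> A \<subseteq> B \<Longrightarrow> vn_bounded A"
  unfolding vn_bounded_def absorbs_def by (meson subset_trans)

lemma in_DP_if_bPC_and_ext:
  fixes C :: "'a::locally_convex_space set"
  assumes E: "infrabarreled TYPE('a)" and C: "convex C" and x: "x \<in> bPC C"
    and ext: "bidual_embedding x \<in> ext (bidual_closure C)"
  shows "x \<in> DP C"
  unfolding DP_iff_slices
proof (intro conjI ballI)
  have xPC: "x \<in> PC C" using x by (simp add: bPC_def)
  then show xC: "x \<in> C" by (simp add: PC_def)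
  fix U assume "U \<in> neighbourhoods euclidean x"
  then obtain W where W: "W \<in> neighbourhoods weak_topology x" "W \<inter> C \<subseteq> U"
    using xPC unfolding PC_def by blast
  obtain W' where W': "W' \<in> neighbourhoods weak_topology x" "vn_bounded (W' \<inter> C)"
    using x unfolding bPC_def by blast
  obtain \<Phi>1 e1 where 1: "finite \<Phi>1" "0 < e1"
      "{y. \<forall>f\<in>\<Phi>1. \<bar>dual_apply f y - dual_apply f x\<bar> < e1} \<subseteq> W"
    using weak_neighbourhood_basic[OF W(1)] by blast
  obtain \<Phi>2 e2 where 2: "finite \<Phi>2" "0 < e2"
      "{y. \<forall>f\<in>\<Phi>2. \<bar>dual_apply f y - dual_apply f x\<bar> < e2} \<subseteq> W'"
    using weak_neighbourhood_basic[OF W'(1)] by blast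
  define \<Phi> where "\<Phi> = \<Phi>1 \<union> \<Phi>2"
  define e where "e = min e1 e2"
  define D where "D = {y \<in> C. \<forall>f\<in>\<Phi>. \<bar>dual_apply f y - dual_apply f x\<bar> < e}"
  have e: "0 < e" using 1 2 by (simp add: e_def)
  have DC: "D \<subseteq> C" and DU: "D \<subseteq> U" and DW': "D \<subseteq> W' \<inter> C"
    using 1(3) 2(3) W(2) by (auto simp: D_def e_def \<Phi>_def)
  have xD: "x \<in> D" using xC e by (simp add: D_def)
  have "D = C \<inter> (\<Inter>f\<in>\<Phi>. dual_apply f -` {dual_apply f x - e<..<dual_apply f x + e})"
    by (auto simp: D_def abs_less_iff)
  then have D: "convex D"
    using C by (simp add: convex_Int convex_INT convex_linear_vimage linear_dual_apply)
  \<comment> \<open>The sign \<open>s\<close> splits the absolute value into two convex conditions.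
    The threshold \<open>e / 2\<close> lies below the radius \<open>e\<close> of \<open>D\<close>,
    so a segment in \<open>C\<close> from \<open>x\<close> to a point outside \<open>D\<close> meets
    one of these sets.\<close>
  define A where "A = (\<lambda>(f, s). {y \<in> D. e / 2 \<le> s * (dual_apply f y - dual_apply f x)})"
  have "x \<notin> closure (convex hull (\<Union>i\<in>\<Phi> \<times> {1, - 1}. A i))"
  proof (rule notin_closure_convex_hull_Union[OF E D])
    show "vn_bounded D" using W'(2) DW' by (rule vn_bounded_subset)
    show "x \<in> PC D" using xPC xD DC by (rule PC_subset)
    show "bidual_embedding x \<in> ext (bidual_closure D)"
      using ext bidual_embedding_in_bidual_closure[OF xD]
      by (rule ext_subset) (unfold bidual_closure_def, intro closure_mono image_mono DC)
    show "finite (\<Phi> \<times> {1, - 1 :: real})" using 1 2 by (simp add: \<Phi>_def)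
    fix i assume "i \<in> \<Phi> \<times> {1, - 1 :: real}"
    obtain f s where i: "i = (f, s)" by (cases i)
    define g where "g = s *\<^sub>R f"
    have A: "A i = D \<inter> {y. dual_apply (- g) y \<le> - (e / 2) - dual_apply g x}"
      by (auto simp: A_def i g_def scaleR_dual.rep_eq uminus_dual.rep_eq algebra_simps)
    have "closure (A i) \<subseteq> {y. dual_apply (- g) y \<le> - (e / 2) - dual_apply g x}"
      unfolding A by (intro closure_minimal closed_half_space) auto
    then have "x \<notin> closure (A i)" using e by (auto simp: uminus_dual.rep_eq)
    moreover have "convex (A i)" unfolding A by (intro convex_Int D convex_half_space)
    ultimately show "convex (A i) \<and> A i \<subseteq> D \<and> x \<notin> closure (A i)" by (simp add: A)
  qed
  then obtain g \<alpha> where g: "\<alpha> < dual_apply g x"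
      "\<And>k. k \<in> convex hull (\<Union>i\<in>\<Phi> \<times> {1, - 1}. A i) \<Longrightarrow> dual_apply g k \<le> \<alpha>"
    using separation_closure_convex[OF convex_convex_hull] by metis
  have small: "dual_apply g y \<le> \<alpha>"
    if "y \<in> D" "f \<in> \<Phi>" "e / 2 \<le> \<bar>dual_apply f y - dual_apply f x\<bar>" for y f
  proof -
    have "y \<in> A (f, 1) \<or> y \<in> A (f, - 1)"
      using that by (cases "dual_apply f x \<le> dual_apply f y") (auto simp: A_def)
    then show ?thesis using \<open>f \<in> \<Phi>\<close> by (intro g(2) hull_inc) auto
  qed
  have "c \<in> D" if c: "c \<in> C" "\<alpha> < dual_apply g c" for c
  proof (rule ccontr)
    text \<open>Otherwise the segment from \<open>x\<close> to \<open>c\<close> meets one of the sets \<open>A i\<close>, all of which lie in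
      the half space \<open>g \<le> \<alpha>\<close>, whereas \<open>g > \<alpha>\<close> at both end points.\<close>
    assume "c \<notin> D"
    define h where "h f = \<bar>dual_apply f c - dual_apply f x\<bar>" for f
    define M where "M = Max (h ` \<Phi>)"
    obtain f0 where f0: "f0 \<in> \<Phi>" "e \<le> h f0" using \<open>c \<notin> D\<close> c(1) by (force simp: D_def h_def)
    have fin: "finite (h ` \<Phi>)" using 1 2 by (simp add: \<Phi>_def)
    have "M \<in> h ` \<Phi>" unfolding M_def using fin f0 by (intro Max_in) auto
    then obtain f where f: "f \<in> \<Phi>" "h f = M" by blast
    have hM: "h k \<le> M" if "k \<in> \<Phi>" for k unfolding M_def using fin that by (intro Max_ge) auto
    have M: "e \<le> M" using hM[OF f0(1)] f0(2) by simp
    \<comment> \<open>\<open>M\<close> is the largest deviation of \<open>c\<close>, so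
      \<open>t\<close> scales it to exactly \<open>e / 2\<close>: the functional \<open>f\<close>
      puts \<open>y\<close> in one of the sets \<open>A i\<close>, and the others deviate by at most
      \<open>e / 2\<close>, which keeps \<open>y\<close> in \<open>D\<close>.\<close>
    define t where "t = e / 2 / M"
    have t: "0 < t" "t < 1" "t * M = e / 2" using e M by (auto simp: t_def field_simps)
    define y where "y = (1 - t) *\<^sub>R x + t *\<^sub>R c"
    have y: "dual_apply k y = (1 - t) * dual_apply k x + t * dual_apply k c" for k
      by (simp add: y_def linear_add[OF linear_dual_apply] linear_scale[OF linear_dual_apply])
    have dist: "\<bar>dual_apply k y - dual_apply k x\<bar> = t * h k" for k
    proof -
      have "dual_apply k y - dual_apply k x = t * (dual_apply k c - dual_apply k x)"
        by (simp add: y algebra_simps)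
      then show ?thesis using t by (simp add: abs_mult h_def)
    qed
    have "y \<in> C" unfolding y_def using t c xC by (intro convexD[OF C]) auto
    moreover have "t * h k < e" if "k \<in> \<Phi>" for k
    proof -
      have "t * h k \<le> t * M" using t hM[OF that] by (intro mult_left_mono) auto
      then show ?thesis using t e by simp
    qed
    ultimately have "y \<in> D" by (simp add: D_def dist)
    then have "dual_apply g y \<le> \<alpha>" using f t by (intro small[of y f]) (auto simp: dist)
    moreover have "(1 - t) * \<alpha> + t * \<alpha> < (1 - t) * dual_apply g x + t * dual_apply g c"
      using g(1) c(2) t by (intro add_strict_mono mult_strict_left_mono) auto
    ultimately show False unfolding y by (simp add: algebra_simps)
  qed
  with g(1) DU show "\<exists>f \<alpha>. \<alpha> < dual_apply f x \<and> (\<forall>c\<in>C. \<alpha> < dual_apply f c \<longrightarrow> c \<in> U)" by blast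
qed

theorem theorem2p19:
  fixes C :: "'a::locally_convex_space set"
  assumes "infrabarreled TYPE('a)"
    and "convex C"
  shows "bDP C = bPC C \<inter> bidual_embedding -` ext (bidual_closure C)"
proof
  \<comment> \<open>Both sides carry the same boundedness clause, so only \<open>DP\<close>,
    \<open>PC\<close> and extremality remain to be compared.\<close>
  show "bDP C \<subseteq> bPC C \<inter> bidual_embedding -` ext (bidual_closure C)"
    using DP_subset_PC[of C] DP_imp_ext_bidual_closure by (auto simp: bDP_def bPC_def)
  show "bPC C \<inter> bidual_embedding -` ext (bidual_closure C) \<subseteq> bDP C"
    using in_DP_if_bPC_and_ext[OF assms] by (auto simp: bDP_def bPC_def)
qed

end
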